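(* Let $(\gamma_i)_{i\in\mathbb{N}}$ be a sequence of (real or complex) subgaussian random variables over a probability space $(\Omega,\mathcal{A},\mathbb{P})$ such that $s=\sup_i \mathrm{sg}(\gamma_i)<\infty$. (1) There is a constant $C_2=C(s)>0$, depending only on $s$, such that for all $K,N\in\mathbb{N}$ and every choice of $a_1,\dots,a_K\in\ell_\infty^N$ with $a_i=(a_i(j))_{j=1}^N$, $$\Big\|\sum_{i=1}^K\gamma_i a_i\Big\|_{L_{\varphi_2}(\ell_\infty^N)}\le C_2(1+\log N)^{1/2}\sup_{1\le j\le N}\big\|(a_i(j))_{i=1}^K\big\|_{\ell_2}.$$ (2) Assume additionally that $M=\sup_i\|\gamma_i\|_\infty<\infty$. Then for every $r\in(2,\infty)$ there is a constant $C_r=C(r,s,M)>0$, depending only on $r,s,M$, such that for all $K,N\in\mathbb{N}$ and every choice of $a_1,\dots,a_K\in\ell_\infty^N$ with $a_i=(a_i(j))_{j=1}^N$, $$\Big\|\sum_{i=1}^K\gamma_i a_i\Big\|_{L_{\varphi_r}(\ell_\infty^N)}\le C_r(1+\log N)^{1/r}\sup_{1\le j\le N}\big\|(a_i(j))_{i=1}^K\big\|_{\ell_{r',\infty}}.$$ Moreover, for a fixed sequence $(\gamma_i)$ and $r\in[2,\infty)$ let $C(N,r)$ be the best (smallest) constant $c$ such that for all $K\in\mathbb{N}$ and all $a_1,\dots,a_K\in\ell_\infty^N$ one has $\|\sum_{i=1}^K\gamma_i a_i\|_{L_{\varphi_r}(\ell_\infty^N)}\le c\,\sup_{1\le j\le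 N}\|(a_i(j))_{i=1}^K\|_{S}$, where $S=\ell_2$ if $r=2$ and $S=\ell_{r',\infty}$ if $r>2$. Then for normal Gaussian, Rademacher or Steinhaus variables, $C(N,2)\asymp(1+\log N)^{1/2}$ up to universal constants; and for $r\in(2,\infty)$ and Rademacher or Steinhaus random variables, $C(N,r)\asymp(1+\log N)^{1/r}$ up to constants depending only on $r$.
   Context: A real random variable $f$ is subgaussian if there is $s\ge0$ with $\mathbb{E}\exp(xf)\le\exp(s^2x^2/2)$ for all $x\in\mathbb{R}$; a complex random variable $f$ is subgaussian if there is $s\ge0$ with $\mathbb{E}\exp(\mathrm{Re}(zf))\le\exp(s^2|z|^2/2)$ for all $z\in\mathbb{C}$. The best such $s$ is denoted $\mathrm{sg}(f)$. Rademacher variables take values $\pm1$ with probability $1/2$; Steinhaus variables are uniformly distributed on the unit circle $\mathbb{T}$; normal Gaussian variables may be real or complex. For $1\le r<\infty$ let $\varphi_r(t)=e^{t^r}-1$ and $\|f\|_{L_{\varphi_r}}=\inf\{\varepsilon>0:\int_\Omega\varphi_r(|f|/\varepsilon)\,d\mathbb{P}\le1\}$. For a Banach space $E$ and an $E$-valued random variable $f$, $\|f\|_{L_{\varphi_r}(E)}=\big\|\,\|f(\cdot)\|_E\big\|_{L_{\varphi_r}}$. $\ell_\infty^N$ is the space of scalar $N$-tuples with the maximum norm. Here $1/r+1/r'=1$, and $\|x\|_{\ell_{r',\infty}}=\sup_n n^{1/r'}x_n^*$, where $(x_n^* )$ is the decreasing rearrangement of $(|x_n|)$.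
   Formalization: The random variables γ_i are assumed independent; without independence the estimates fail, e.g. for γ_i all equal to one Rademacher variable, N = 1 and a_i = 1, where the left side grows like K. *)

theory Defs
  imports "HOL-Probability.Probability"
begin

section \<open>Subgaussian random variables\<close>

text \<open>
  Exponential moments are taken as nonnegative integrals, so that a divergent moment is
  infinite rather than 0.
\<close>

definition real_subgaussian_with :: "'w measure \<Rightarrow> ('w \<Rightarrow> real) \<Rightarrow> real \<Rightarrow> bool" where
  "real_subgaussian_with M f s \<longleftrightarrow> 0 \<le> s \<and>
     (\<forall>x::real. (\<integral>\<^sup>+\<omega>. ennreal (exp (x * f \<omega>)) \<partial>M) \<le> ennreal (exp (s\<^sup>2 * x\<^sup>2 / 2)))"

definition complex_subgaussian_with :: "'w measure \<Rightarrow> ('w \<Rightarrow> complex) \<Rightarrow> real \<Rightarrow> bool" where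
  "complex_subgaussian_with M f s \<longleftrightarrow> 0 \<le> s \<and>
     (\<forall>z::complex. (\<integral>\<^sup>+\<omega>. ennreal (exp (Re (z * f \<omega>))) \<partial>M) \<le> ennreal (exp (s\<^sup>2 * (norm z)\<^sup>2 / 2)))"

definition real_subgaussian :: "'w measure \<Rightarrow> ('w \<Rightarrow> real) \<Rightarrow> bool" where
  "real_subgaussian M f \<longleftrightarrow> f \<in> borel_measurable M \<and> (\<exists>s. real_subgaussian_with M f s)"

definition complex_subgaussian :: "'w measure \<Rightarrow> ('w \<Rightarrow> complex) \<Rightarrow> bool" where
  "complex_subgaussian M f \<longleftrightarrow> f \<in> borel_measurable M \<and> (\<exists>s. complex_subgaussian_with M f s)"

definition real_sg :: "'w measure \<Rightarrow> ('w \<Rightarrow> real) \<Rightarrow> real" where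
  "real_sg M f = Inf {s. real_subgaussian_with M f s}"

definition complex_sg :: "'w measure \<Rightarrow> ('w \<Rightarrow> complex) \<Rightarrow> real" where
  "complex_sg M f = Inf {s. complex_subgaussian_with M f s}"

definition indep_seq :: "'w measure \<Rightarrow> (nat \<Rightarrow> 'w \<Rightarrow> 'k::real_normed_field) \<Rightarrow> bool" where
  "indep_seq M \<gamma> \<longleftrightarrow> prob_space M \<and> prob_space.indep_vars M (\<lambda>_. borel) \<gamma> UNIV"

text \<open>
  Sequences of subgaussian variables whose supremum of sg is finite and equals \<open>s\<close>.
  Independence is part of the definition: if all terms are the same Rademacher variable,
  even the scalar estimate against the \<open>\<ell>\<^sub>2\<close>-norm of the coefficients fails.
\<close>

definition real_subgaussian_seq :: "'w measure \<Rightarrow> (nat \<Rightarrow> 'w \<Rightarrow> real) \<Rightarrow> real \<Rightarrow> bool" where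
  "real_subgaussian_seq M \<gamma> s \<longleftrightarrow> indep_seq M \<gamma> \<and> (\<forall>i. real_subgaussian M (\<gamma> i)) \<and>
     bdd_above (range (\<lambda>i. real_sg M (\<gamma> i))) \<and> s = (SUP i. real_sg M (\<gamma> i))"

definition complex_subgaussian_seq :: "'w measure \<Rightarrow> (nat \<Rightarrow> 'w \<Rightarrow> complex) \<Rightarrow> real \<Rightarrow> bool" where
  "complex_subgaussian_seq M \<gamma> s \<longleftrightarrow> indep_seq M \<gamma> \<and> (\<forall>i. complex_subgaussian M (\<gamma> i)) \<and>
     bdd_above (range (\<lambda>i. complex_sg M (\<gamma> i))) \<and> s = (SUP i. complex_sg M (\<gamma> i))"

definition sup_Linf_norm :: "'w measure \<Rightarrow> (nat \<Rightarrow> 'w \<Rightarrow> 'k::real_normed_field) \<Rightarrow> ereal" where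
  "sup_Linf_norm M \<gamma> = (SUP i. esssup M (\<lambda>\<omega>. ereal (norm (\<gamma> i \<omega>))))"

section \<open>Special sequences\<close>

definition rademacher_seq :: "'w measure \<Rightarrow> (nat \<Rightarrow> 'w \<Rightarrow> real) \<Rightarrow> bool" where
  "rademacher_seq M \<gamma> \<longleftrightarrow> indep_seq M \<gamma> \<and>
     (\<forall>i. measure M {\<omega> \<in> space M. \<gamma> i \<omega> = 1} = 1/2 \<and> measure M {\<omega> \<in> space M. \<gamma> i \<omega> = -1} = 1/2)"

definition steinhaus_seq :: "'w measure \<Rightarrow> (nat \<Rightarrow> 'w \<Rightarrow> complex) \<Rightarrow> bool" where
  "steinhaus_seq M \<gamma> \<longleftrightarrow> indep_seq M \<gamma> \<and>
     (\<forall>i. distr M borel (\<gamma> i) =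
          distr (uniform_measure lborel {0..1::real}) borel (\<lambda>t. cis (2 * pi * t)))"

definition real_gaussian_seq :: "'w measure \<Rightarrow> (nat \<Rightarrow> 'w \<Rightarrow> real) \<Rightarrow> bool" where
  "real_gaussian_seq M \<gamma> \<longleftrightarrow> indep_seq M \<gamma> \<and>
     (\<forall>i. distributed M lborel (\<gamma> i) (\<lambda>x. ennreal (std_normal_density x)))"

text \<open>
  Normalisation \<open>E \<bar>\<gamma>\<bar>\<^sup>2 = 1\<close>, i.e. density \<open>exp (- \<bar>z\<bar>\<^sup>2) / \<pi>\<close> on the plane: the real and
  imaginary parts are independent centred real Gaussians of variance 1/2.
\<close>

definition complex_gaussian_seq :: "'w measure \<Rightarrow> (nat \<Rightarrow> 'w \<Rightarrow> complex) \<Rightarrow> bool" where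
  "complex_gaussian_seq M \<gamma> \<longleftrightarrow> indep_seq M \<gamma> \<and>
     (\<forall>i. prob_space.indep_var M borel (\<lambda>\<omega>. Re (\<gamma> i \<omega>)) borel (\<lambda>\<omega>. Im (\<gamma> i \<omega>)) \<and>
          distributed M lborel (\<lambda>\<omega>. Re (\<gamma> i \<omega>)) (\<lambda>x. ennreal (normal_density 0 (1 / sqrt 2) x)) \<and>
          distributed M lborel (\<lambda>\<omega>. Im (\<gamma> i \<omega>)) (\<lambda>x. ennreal (normal_density 0 (1 / sqrt 2) x)))"

section \<open>Norms\<close>

definition phi :: "real \<Rightarrow> real \<Rightarrow> real" where
  "phi r t = exp (t powr r) - 1"

text \<open>The Luxemburg norm; its value is \<open>\<infinity>\<close> outside the Orlicz space.\<close>

definition orlicz_norm :: "'w measure \<Rightarrow> real \<Rightarrow> ('w \<Rightarrow> real) \<Rightarrow> ennreal" where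
  "orlicz_norm M r f =
     (INF \<epsilon> \<in> {\<epsilon>::real. 0 < \<epsilon> \<and> (\<integral>\<^sup>+\<omega>. ennreal (phi r (\<bar>f \<omega>\<bar> / \<epsilon>)) \<partial>M) \<le> 1}. ennreal \<epsilon>)"

text \<open>
  Finite tuples \<open>(x\<^sub>1, \<dots>, x\<^sub>N)\<close> are functions on \<open>nat\<close> of which only the values at indices
  below \<open>N\<close> matter; the norms below are used for nonempty tuples only.
\<close>

definition linf_norm :: "nat \<Rightarrow> (nat \<Rightarrow> 'k::real_normed_field) \<Rightarrow> real" where
  "linf_norm N x = (MAX j\<in>{..<N}. norm (x j))"

definition l2_norm :: "nat \<Rightarrow> (nat \<Rightarrow> 'k::real_normed_field) \<Rightarrow> real" where
  "l2_norm K x = L2_set (\<lambda>i. norm (x i)) {..<K}"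

definition decreasing_rearrangement :: "nat \<Rightarrow> (nat \<Rightarrow> 'k::real_normed_field) \<Rightarrow> real list" where
  "decreasing_rearrangement K x = rev (sort (map (\<lambda>i. norm (x i)) [0..<K]))"

text \<open>
  Positions in the rearrangement are counted from 0, hence the factor \<open>(n + 1)\<^bsup>1/p\<^esup>\<close>.
\<close>

definition weak_lp_norm :: "real \<Rightarrow> nat \<Rightarrow> (nat \<Rightarrow> 'k::real_normed_field) \<Rightarrow> real" where
  "weak_lp_norm p K x =
     (MAX n\<in>{..<K}. real (n + 1) powr (1 / p) * (decreasing_rearrangement K x ! n))"

definition conjugate_exponent :: "real \<Rightarrow> real" where
  "conjugate_exponent r = r / (r - 1)"

lemma conjugate_exponent: "1 < r \<Longrightarrow> 1 / r + 1 / conjugate_exponent r = 1"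
  by (simp add: conjugate_exponent_def field_simps)

section \<open>Estimates for random sums and their best constants\<close>

text \<open>
  \<open>a i j\<close> is the \<open>j\<close>-th coordinate of the vector \<open>a\<^sub>i\<close>; \<open>S K\<close> is the norm used on
  \<open>K\<close>-tuples. The scalar field \<open>'k\<close> is that of the variables and of the coefficients; real
  variables with complex coefficients are obtained by composing the variables with \<open>of_real\<close>.
\<close>

definition sum_estimate ::
  "'w measure \<Rightarrow> (nat \<Rightarrow> 'w \<Rightarrow> 'k::real_normed_field) \<Rightarrow> real \<Rightarrow> (nat \<Rightarrow> (nat \<Rightarrow> 'k) \<Rightarrow> real)
     \<Rightarrow> nat \<Rightarrow> ennreal \<Rightarrow> bool" where
  "sum_estimate M \<gamma> r S N c \<longleftrightarrow>
     (\<forall>K\<ge>1. \<forall>a :: nat \<Rightarrow> nat \<Rightarrow> 'k.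
        orlicz_norm M r (\<lambda>\<omega>. linf_norm N (\<lambda>j. \<Sum>i<K. \<gamma> i \<omega> * a i j))
          \<le> c * ennreal (MAX j\<in>{..<N}. S K (\<lambda>i. a i j)))"

definition best_constant ::
  "'w measure \<Rightarrow> (nat \<Rightarrow> 'w \<Rightarrow> 'k::real_normed_field) \<Rightarrow> nat \<Rightarrow> real \<Rightarrow> ennreal" where
  "best_constant M \<gamma> N r =
     Inf {c. sum_estimate M \<gamma> r
               (if r = 2 then l2_norm else weak_lp_norm (conjugate_exponent r)) N c}"

end

theory Submission
  imports Defs "HOL-Combinatorics.Permutations"
begin

text \<open>
  Integrating the Laplace transform bound of a subgaussian variable against a Gaussian gives a
  bounded exponential moment of its square, and the maximum over \<open>N\<close> coordinates costs only a
  factor of order \<open>1 + log N\<close> in the exponent. For \<open>r > 2\<close> the exponential moment of order \<open>r\<close> comes from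
  splitting the coefficients, at every level \<open>m\<close>, into the \<open>m\<close> largest ones, to which boundedness
  applies, and the rest, to which the subgaussian bound applies. The lower bounds are attained by
  the matrix of all sign patterns, for which the maximum is comparable to the sum of the \<open>\<bar>\<gamma>\<^sub>i\<bar>\<close>.
\<close>

section \<open>Exponential moments of subgaussian sums\<close>

text \<open>The analysis is done once, over the complex numbers. A real variable keeps its
  subgaussian parameter as a complex one, and real coefficients are special complex ones; for real
  sequences a lower bound over the reals and an upper bound over the complex numbers therefore
  settle both scalar fields. For r > 2 neither tool suffices alone. A subgaussian variable need not
  have exponential moments of order r, so boundedness has to enter; but the moduli n^(-1/r') have a
  divergent sum, so boundedness cannot be applied to all terms. Their squares are summable since r'
  < 2. A head of length m has sum of order m^(1/r), the tail has l_2-norm of order m^(1/r - 1/2),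
  and the ratio sqrt m is exactly what turns a Gaussian tail into a probability exp(-c m). For the
  lower bound, each column of K signs has norm K^(1 - 1/r) while the maximum is of order K. The
  quotient K^(1/r) has the right size because 2^(K-1) columns are enough, so that K is of order log
  N.\<close>

text \<open>The chord of \<open>exp\<close> over the segment from 0 to \<open>y\<close>. It stands
  in for Jensen's inequality: being affine in \<open>exp y\<close>, the bound can be summed over
  coordinates and integrated termwise.\<close>

lemma exp_scale_le:
  fixes p y :: real
  assumes "0 \<le> p" "p \<le> 1"
  shows "exp (p * y) \<le> 1 - p + p * exp y"
  using convex_onD[OF exp_convex, of p 0 y] assms by simp

text \<open>Completing the square. With \<open>\<sigma> = 1\<close> it linearises the square of a
  subgaussian variable; for general \<open>\<sigma>\<close> it is the Laplace transform of the
  Gaussian examples.\<close>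

lemma nn_integral_normal_exp:
  assumes "0 < \<sigma>"
  shows "(\<integral>\<^sup>+g. ennreal (normal_density 0 \<sigma> g) * ennreal (exp (a * g)) \<partial>lborel)
    = ennreal (exp (\<sigma>\<^sup>2 * a\<^sup>2 / 2))"
proof -
  have "ennreal (normal_density 0 \<sigma> g) * ennreal (exp (a * g))
      = ennreal (exp (\<sigma>\<^sup>2 * a\<^sup>2 / 2)) * ennreal (normal_density (\<sigma>\<^sup>2 * a) \<sigma> g)" for g
  proof -
    have "- g\<^sup>2 / (2 * \<sigma>\<^sup>2) + a * g = \<sigma>\<^sup>2 * a\<^sup>2 / 2 + - (g - \<sigma>\<^sup>2 * a)\<^sup>2 / (2 * \<sigma>\<^sup>2)"
      using assms by (simp add: field_simps) (simp add: power2_eq_square power4_eq_xxxx algebra_simps)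
    then have "normal_density 0 \<sigma> g * exp (a * g) = exp (\<sigma>\<^sup>2 * a\<^sup>2 / 2) * normal_density (\<sigma>\<^sup>2 * a) \<sigma> g"
      by (simp add: normal_density_def mult_exp_exp)
    then show ?thesis by (simp flip: ennreal_mult)
  qed
  moreover have "(\<integral>\<^sup>+g. ennreal (normal_density (\<sigma>\<^sup>2 * a) \<sigma> g) \<partial>lborel) = 1"
    using assms by (subst nn_integral_eq_integral) auto
  ultimately show ?thesis by (simp add: nn_integral_cmult)
qed

text \<open>The tilt halves the exponent of the standard normal density, which gives variance 2;
  \<open>sqrt 2\<close> is the ratio of the normalising constants.\<close>

lemma nn_integral_std_normal_exp_square:
  "(\<integral>\<^sup>+g. ennreal (std_normal_density g) * ennreal (exp (g\<^sup>2 / 4)) \<partial>lborel) = ennreal (sqrt 2)"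
proof -
  have "ennreal (std_normal_density g) * ennreal (exp (g\<^sup>2 / 4))
      = ennreal (sqrt 2) * ennreal (normal_density 0 (sqrt 2) g)" for g
  proof -
    have "std_normal_density g * exp (g\<^sup>2 / 4) = sqrt 2 * normal_density 0 (sqrt 2) g"
      by (simp add: normal_density_def mult_exp_exp real_sqrt_mult field_simps)
    then show ?thesis by (simp flip: ennreal_mult)
  qed
  moreover have "(\<integral>\<^sup>+g. ennreal (normal_density 0 (sqrt 2) g) \<partial>lborel) = 1"
    by (subst nn_integral_eq_integral) auto
  ultimately show ?thesis by (simp add: nn_integral_cmult)
qed

lemma real_subgaussian_exp_square:
  assumes "prob_space M" and [measurable]: "X \<in> borel_measurable M"
    and sub: "real_subgaussian_with M X \<sigma>" and "0 < \<sigma>"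
  shows "(\<integral>\<^sup>+\<omega>. ennreal (exp ((X \<omega>)\<^sup>2 / (4 * \<sigma>\<^sup>2))) \<partial>M) \<le> 2"
proof -
  interpret prob_space M by fact
  interpret pair_sigma_finite M "lborel :: real measure" ..
  \<comment> \<open>Chosen so that averaging exp(b X g) over a standard normal g yields exp(X^2 / (4
    \<sigma>^2)). After Fubini the subgaussian bound gives exp(g^2 / 4), which the Gaussian density
    still dominates; with 2 in place of 4 the integral would diverge.\<close>
  define b where "b = 1 / (\<sigma> * sqrt 2)"
  have b2: "(b * t)\<^sup>2 / 2 = t\<^sup>2 / (4 * \<sigma>\<^sup>2)" for t
    by (simp add: b_def power_mult_distrib power_divide)
  have "(\<integral>\<^sup>+\<omega>. ennreal (exp ((X \<omega>)\<^sup>2 / (4 * \<sigma>\<^sup>2))) \<partial>M)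
      = (\<integral>\<^sup>+\<omega>. \<integral>\<^sup>+g. ennreal (std_normal_density g) * ennreal (exp (b * X \<omega> * g)) \<partial>lborel \<partial>M)"
    by (simp only: nn_integral_normal_exp[OF zero_less_one] power_one mult_1 b2)
  also have "\<dots> = (\<integral>\<^sup>+g. \<integral>\<^sup>+\<omega>. ennreal (std_normal_density g) * ennreal (exp (b * X \<omega> * g)) \<partial>M \<partial>lborel)"
    by (rule Fubini'[symmetric]) measurable
  also have "\<dots> = (\<integral>\<^sup>+g. ennreal (std_normal_density g) * (\<integral>\<^sup>+\<omega>. ennreal (exp ((b * g) * X \<omega>)) \<partial>M) \<partial>lborel)"
    by (simp add: nn_integral_cmult ac_simps)
  also have "\<dots> \<le> (\<integral>\<^sup>+g. ennreal (std_normal_density g) * ennreal (exp (g\<^sup>2 / 4)) \<partial>lborel)"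
  proof (intro nn_integral_mono mult_left_mono)
    fix g :: real
    have "(\<integral>\<^sup>+\<omega>. ennreal (exp ((b * g) * X \<omega>)) \<partial>M) \<le> ennreal (exp (\<sigma>\<^sup>2 * (b * g)\<^sup>2 / 2))"
      using sub unfolding real_subgaussian_with_def by blast
    also have "\<sigma>\<^sup>2 * (b * g)\<^sup>2 / 2 = g\<^sup>2 / 4"
      using \<open>0 < \<sigma>\<close> by (simp add: b_def power_mult_distrib power_divide)
    finally show "(\<integral>\<^sup>+\<omega>. ennreal (exp ((b * g) * X \<omega>)) \<partial>M) \<le> ennreal (exp (g\<^sup>2 / 4))" .
  qed simp
  also have "\<dots> \<le> 2"
    unfolding nn_integral_std_normal_exp_square
    by (simp flip: ennreal_numeral add: ennreal_leI real_le_lsqrt)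
  finally show ?thesis .
qed

section \<open>Complex subgaussian variables and their independent sums\<close>

lemma complex_subgaussian_with_mono:
  assumes "complex_subgaussian_with M f s" "s \<le> t"
  shows "complex_subgaussian_with M f t"
  unfolding complex_subgaussian_with_def
proof (intro conjI allI)
  show "0 \<le> t" using assms by (simp add: complex_subgaussian_with_def)
  fix z :: complex
  have "s\<^sup>2 * (norm z)\<^sup>2 / 2 \<le> t\<^sup>2 * (norm z)\<^sup>2 / 2"
    using assms by (intro divide_right_mono mult_right_mono power_mono) (auto simp: complex_subgaussian_with_def)
  moreover have "(\<integral>\<^sup>+\<omega>. ennreal (exp (Re (z * f \<omega>))) \<partial>M) \<le> ennreal (exp (s\<^sup>2 * (norm z)\<^sup>2 / 2))"
    using assms unfolding complex_subgaussian_with_def by blast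
  ultimately show "(\<integral>\<^sup>+\<omega>. ennreal (exp (Re (z * f \<omega>))) \<partial>M) \<le> ennreal (exp (t\<^sup>2 * (norm z)\<^sup>2 / 2))"
    by (meson ennreal_leI exp_le_cancel_iff order_trans)
qed

lemma complex_subgaussian_with_Re_Im:
  assumes "complex_subgaussian_with M f s"
  shows "real_subgaussian_with M (\<lambda>\<omega>. Re (f \<omega>)) s" "real_subgaussian_with M (\<lambda>\<omega>. Im (f \<omega>)) s"
proof -
  have *: "(\<integral>\<^sup>+\<omega>. ennreal (exp (Re (z * f \<omega>))) \<partial>M) \<le> ennreal (exp (s\<^sup>2 * (norm z)\<^sup>2 / 2))" for z
    using assms unfolding complex_subgaussian_with_def by blast
  have "0 \<le> s" using assms by (simp add: complex_subgaussian_with_def)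
  \<comment> \<open>The second choice of z isolates the imaginary part, because Re (- i x f) = x Im
    f.\<close>
  then show "real_subgaussian_with M (\<lambda>\<omega>. Re (f \<omega>)) s" "real_subgaussian_with M (\<lambda>\<omega>. Im (f \<omega>)) s"
    unfolding real_subgaussian_with_def using *[of "complex_of_real _"] *[of "Complex 0 (- _)"]
    by (simp_all add: cmod_def)
qed

text \<open>Real and imaginary parts may be dependent, so the exponential does not factorise in
  expectation. Instead the exponent is written as the mean of the two real exponents, and the
  exponential of a mean is at most the sum of the exponentials. This doubles both constants of the
  real case.\<close>

lemma complex_subgaussian_exp_square:
  assumes "prob_space M" and [measurable]: "f \<in> borel_measurable M"
    and sub: "complex_subgaussian_with M f \<sigma>" and "0 < \<sigma>"
  shows "(\<integral>\<^sup>+\<omega>. ennreal (exp ((norm (f \<omega>))\<^sup>2 / (8 * \<sigma>\<^sup>2))) \<partial>M) \<le> 4"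
proof -
  have le: "exp ((a + b) / 2) \<le> exp a + exp b" for a b :: real
  proof (cases "a \<le> b")
    case True
    then have "exp ((a + b) / 2) \<le> exp b" by simp
    then show ?thesis by (simp add: add_increasing)
  next
    case False
    then have "exp ((a + b) / 2) \<le> exp a" by simp
    then show ?thesis by (simp add: add_increasing2)
  qed
  have "(\<integral>\<^sup>+\<omega>. ennreal (exp ((norm (f \<omega>))\<^sup>2 / (8 * \<sigma>\<^sup>2))) \<partial>M)
    \<le> (\<integral>\<^sup>+\<omega>. ennreal (exp ((Re (f \<omega>))\<^sup>2 / (4 * \<sigma>\<^sup>2))) + ennreal (exp ((Im (f \<omega>))\<^sup>2 / (4 * \<sigma>\<^sup>2))) \<partial>M)"
  proof (rule nn_integral_mono)
    fix \<omega>
    have eq: "(norm (f \<omega>))\<^sup>2 / (8 * \<sigma>\<^sup>2) = ((Re (f \<omega>))\<^sup>2 / (4 * \<sigma>\<^sup>2) + (Im (f \<omega>))\<^sup>2 / (4 * \<sigma>\<^sup>2)) / 2"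
      by (simp add: cmod_power2 add_divide_distrib)
    show "ennreal (exp ((norm (f \<omega>))\<^sup>2 / (8 * \<sigma>\<^sup>2)))
      \<le> ennreal (exp ((Re (f \<omega>))\<^sup>2 / (4 * \<sigma>\<^sup>2))) + ennreal (exp ((Im (f \<omega>))\<^sup>2 / (4 * \<sigma>\<^sup>2)))"
      unfolding eq ennreal_plus[symmetric, OF exp_ge_zero exp_ge_zero] by (intro ennreal_leI le)
  qed
  also have "\<dots> = (\<integral>\<^sup>+\<omega>. ennreal (exp ((Re (f \<omega>))\<^sup>2 / (4 * \<sigma>\<^sup>2))) \<partial>M)
      + (\<integral>\<^sup>+\<omega>. ennreal (exp ((Im (f \<omega>))\<^sup>2 / (4 * \<sigma>\<^sup>2))) \<partial>M)"
    by (rule nn_integral_add) measurable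
  also have "\<dots> \<le> 2 + 2"
    using assms complex_subgaussian_with_Re_Im[OF sub]
    by (intro add_mono real_subgaussian_exp_square) auto
  finally show ?thesis by simp
qed

text \<open>Independence factorises the Laplace transform, and the exponents, quadratic in
  \<open>z * x i\<close>, add up. The index set is an arbitrary finite \<open>J\<close> because
  tails of rearranged coefficient sequences have to be covered.\<close>

lemma complex_subgaussian_sum:
  fixes x :: "nat \<Rightarrow> complex"
  assumes "prob_space M" and ind: "prob_space.indep_vars M (\<lambda>_. borel) \<gamma> UNIV"
    and sub: "\<And>i. complex_subgaussian_with M (\<gamma> i) \<sigma>" and "finite J"
  shows "complex_subgaussian_with M (\<lambda>\<omega>. \<Sum>i\<in>J. \<gamma> i \<omega> * x i) (\<sigma> * L2_set (\<lambda>i. norm (x i)) J)"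
  unfolding complex_subgaussian_with_def
proof (intro conjI allI)
  interpret prob_space M by fact
  show "0 \<le> \<sigma> * L2_set (\<lambda>i. norm (x i)) J"
    using sub[of 0] by (simp add: complex_subgaussian_with_def L2_set_nonneg)
  fix z :: complex
  have "indep_vars (\<lambda>_. borel) (\<lambda>i \<omega>. ennreal (exp (Re (z * x i * \<gamma> i \<omega>)))) J"
    by (rule indep_vars_compose2[where M'="\<lambda>_. borel"]) (auto intro: indep_vars_subset[OF ind])
  have "Re (z * (\<Sum>i\<in>J. \<gamma> i \<omega> * x i)) = (\<Sum>i\<in>J. Re (z * x i * \<gamma> i \<omega>))" for \<omega>
    unfolding sum_distrib_left Re_sum by (rule sum.cong) (simp_all only: mult_ac)
  then have "(\<integral>\<^sup>+\<omega>. ennreal (exp (Re (z * (\<Sum>i\<in>J. \<gamma> i \<omega> * x i)))) \<partial>M)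
      = (\<integral>\<^sup>+\<omega>. (\<Prod>i\<in>J. ennreal (exp (Re (z * x i * \<gamma> i \<omega>)))) \<partial>M)"
    by (simp only: prod_ennreal exp_sum \<open>finite J\<close> exp_ge_zero)
  also have "\<dots> = (\<Prod>i\<in>J. \<integral>\<^sup>+\<omega>. ennreal (exp (Re (z * x i * \<gamma> i \<omega>))) \<partial>M)"
    by (rule indep_vars_nn_integral) (use \<open>finite J\<close> \<open>indep_vars _ _ J\<close> in auto)
  also have "\<dots> \<le> (\<Prod>i\<in>J. ennreal (exp (\<sigma>\<^sup>2 * (norm (z * x i))\<^sup>2 / 2)))"
    using sub unfolding complex_subgaussian_with_def by (intro prod_mono_ennreal) blast
  also have "\<dots> = ennreal (exp (\<Sum>i\<in>J. \<sigma>\<^sup>2 * (norm (z * x i))\<^sup>2 / 2))"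
    by (simp add: prod_ennreal exp_sum \<open>finite J\<close>)
  also have "(\<Sum>i\<in>J. \<sigma>\<^sup>2 * (norm (z * x i))\<^sup>2 / 2) = (\<sigma> * L2_set (\<lambda>i. norm (x i)) J)\<^sup>2 * (norm z)\<^sup>2 / 2"
    by (simp add: L2_set_def power_mult_distrib norm_mult sum_nonneg sum_distrib_left sum_distrib_right
        sum_divide_distrib mult_ac)
  finally show "(\<integral>\<^sup>+\<omega>. ennreal (exp (Re (z * (\<Sum>i\<in>J. \<gamma> i \<omega> * x i)))) \<partial>M)
      \<le> ennreal (exp ((\<sigma> * L2_set (\<lambda>i. norm (x i)) J)\<^sup>2 * (norm z)\<^sup>2 / 2))" .
qed

section \<open>From scalar exponential moments to Orlicz norms of maxima\<close>

lemma linf_norm_attained: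
  assumes "1 \<le> N"
  obtains j where "j < N" "linf_norm N x = norm (x j)"
proof -
  have "(MAX j\<in>{..<N}. norm (x j)) \<in> (\<lambda>j. norm (x j)) ` {..<N}"
    using assms by (intro Max_in) (auto simp: lessThan_empty_iff)
  then show ?thesis using that unfolding linf_norm_def by blast
qed

lemma norm_le_linf_norm: "j < N \<Longrightarrow> norm (x j) \<le> linf_norm N x"
  unfolding linf_norm_def by (rule Max_ge) auto

lemma orlicz_norm_leI:
  assumes "0 < \<epsilon>" "(\<integral>\<^sup>+\<omega>. ennreal (phi r (\<bar>f \<omega>\<bar> / \<epsilon>)) \<partial>M) \<le> 1"
  shows "orlicz_norm M r f \<le> ennreal \<epsilon>"
  unfolding orlicz_norm_def using assms by (intro INF_lower) auto

text \<open>
  The exponent is divided by \<open>L \<approx> log (Q N)\<close>; convexity of \<open>exp\<close> then turns the sum of the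
  \<open>N\<close> exponential moments into a bounded quantity.
\<close>

lemma orlicz_norm_linf_le:
  fixes f :: "nat \<Rightarrow> 'w \<Rightarrow> 'k::real_normed_field"
  assumes "prob_space M" and \<kappa>: "0 < \<kappa>" and r: "1 \<le> r" and N: "1 \<le> N" and Q: "1 \<le> Q"
    and meas: "\<And>j. j < N \<Longrightarrow> f j \<in> borel_measurable M"
    and int: "\<And>j. j < N \<Longrightarrow> (\<integral>\<^sup>+\<omega>. ennreal (exp ((norm (f j \<omega>) / \<kappa>) powr r)) \<partial>M) \<le> ennreal Q"
  shows "orlicz_norm M r (\<lambda>\<omega>. linf_norm N (\<lambda>j. f j \<omega>))
    \<le> ennreal (\<kappa> * (2 * (1 + ln Q) * (1 + ln (real N))) powr (1/r))"
proof (rule orlicz_norm_leI)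
  interpret prob_space M by fact
  \<comment> \<open>At least \<open>2 * ln D\<close> and at least 2, so that D^p <= exp (1/2) <= 2
    and p <= 1/2. The product form, rather than a sum of logarithms, lets the power of 1 + ln N
    split off with a factor depending only on \<open>Q\<close>.\<close>
  define L where "L = 2 * (1 + ln Q) * (1 + ln (real N))"
  define p where "p = 1 / L"
  define D where "D = Q * real N"
  have lns: "0 \<le> ln Q" "0 \<le> ln (real N)" using N Q by auto
  have "1 * 1 \<le> (1 + ln Q) * (1 + ln (real N))" using lns by (intro mult_mono) auto
  then have L2: "2 \<le> L" unfolding L_def mult.assoc by linarith
  have p: "0 < p" "p \<le> 1/2" using L2 by (auto simp: p_def field_simps)
  have D: "0 < D" using N Q by (simp add: D_def)
  have "2 * ln D \<le> L"
    using lns N Q by (simp add: D_def L_def ln_mult algebra_simps)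
  then have "p * ln D \<le> 1/2" using L2 by (simp add: p_def field_simps)
  then have "p * ln D \<le> ln 2" using ln2_ge_two_thirds by simp
  then have Dp: "exp (p * ln D) \<le> 2" by (metis exp_le_cancel_iff exp_ln zero_less_numeral)
  define \<epsilon> where "\<epsilon> = \<kappa> * L powr (1/r)"
  show "0 < \<kappa> * (2 * (1 + ln Q) * (1 + ln (real N))) powr (1/r)"
    using L2 \<kappa> unfolding L_def[symmetric] by simp
  define W where "W j \<omega> = exp ((norm (f j \<omega>) / \<kappa>) powr r)" for j \<omega>
  have [measurable]: "f j \<in> borel_measurable M" if "j \<in> {..<N}" for j using meas that by simp
  have W[measurable]: "W j \<in> borel_measurable M" if "j \<in> {..<N}" for j
    unfolding W_def using that by measurable
  \<comment> \<open>The exponent is centred at \<open>ln D\<close> before the chord bound is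
    applied: the sum of the \<open>W j\<close> divided by \<open>D\<close> has expectation at most
    1, so the right-hand side integrates to at most (1 - 2p) + 2p = 1.\<close>
  have bound: "phi r (\<bar>linf_norm N (\<lambda>j. f j \<omega>)\<bar> / \<epsilon>) \<le> (1 - 2 * p) + 2 * p / D * (\<Sum>j<N. W j \<omega>)" for \<omega>
  proof -
    obtain j where j: "j < N" "linf_norm N (\<lambda>j. f j \<omega>) = norm (f j \<omega>)"
      using N by (rule linf_norm_attained)
    define y where "y = (norm (f j \<omega>) / \<kappa>) powr r"
    have "(\<bar>linf_norm N (\<lambda>j. f j \<omega>)\<bar> / \<epsilon>) powr r = p * y"
      using L2 \<kappa> r by (simp add: j y_def \<epsilon>_def p_def powr_divide powr_mult powr_powr)
    also have "\<dots> = p * ln D + p * (y - ln D)" by (simp add: algebra_simps)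
    finally have "exp ((\<bar>linf_norm N (\<lambda>j. f j \<omega>)\<bar> / \<epsilon>) powr r) = exp (p * ln D) * exp (p * (y - ln D))"
      by (simp only: exp_add)
    also have "\<dots> \<le> 2 * (1 - p + p * exp (y - ln D))"
      using p by (intro mult_mono Dp exp_scale_le) auto
    also have "exp (y - ln D) = W j \<omega> / D"
      using D by (simp add: W_def y_def exp_diff)
    also have "W j \<omega> \<le> (\<Sum>j<N. W j \<omega>)"
      using j by (intro member_le_sum) (auto simp: W_def)
    finally show ?thesis using p D by (simp add: phi_def field_simps)
  qed
  have "(\<integral>\<^sup>+\<omega>. ennreal (phi r (\<bar>linf_norm N (\<lambda>j. f j \<omega>)\<bar> / \<epsilon>)) \<partial>M)
    \<le> (\<integral>\<^sup>+\<omega>. ennreal (1 - 2 * p) + ennreal (2 * p / D) * (\<Sum>j<N. ennreal (W j \<omega>)) \<partial>M)"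
  proof (rule nn_integral_mono)
    fix \<omega>
    have W0: "0 \<le> (\<Sum>j<N. W j \<omega>)" by (intro sum_nonneg) (simp add: W_def)
    have "ennreal (1 - 2 * p) + ennreal (2 * p / D) * (\<Sum>j<N. ennreal (W j \<omega>))
        = ennreal ((1 - 2 * p) + 2 * p / D * (\<Sum>j<N. W j \<omega>))"
      using p D W0 by (subst sum_ennreal) (auto simp: W_def simp flip: ennreal_mult)
    then show "ennreal (phi r (\<bar>linf_norm N (\<lambda>j. f j \<omega>)\<bar> / \<epsilon>))
        \<le> ennreal (1 - 2 * p) + ennreal (2 * p / D) * (\<Sum>j<N. ennreal (W j \<omega>))"
      using bound[of \<omega>] by (simp add: ennreal_leI)
  qed
  also have "\<dots> = ennreal (1 - 2 * p) + ennreal (2 * p / D) * (\<Sum>j<N. \<integral>\<^sup>+\<omega>. ennreal (W j \<omega>) \<partial>M)"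
    by (simp add: nn_integral_add nn_integral_cmult nn_integral_sum emeasure_space_1)
  also have "\<dots> \<le> ennreal (1 - 2 * p) + ennreal (2 * p / D) * (\<Sum>j<N. ennreal Q)"
    using int unfolding W_def by (intro add_left_mono mult_left_mono sum_mono) auto
  also have "(\<Sum>j<N. ennreal Q) = ennreal D"
    using Q by (simp add: D_def ennreal_of_nat_eq_real_of_nat mult.commute flip: ennreal_mult)
  also have "ennreal (1 - 2 * p) + ennreal (2 * p / D) * ennreal D = 1"
    using p D by (simp flip: ennreal_mult ennreal_plus)
  finally show "(\<integral>\<^sup>+\<omega>. ennreal (phi r (\<bar>linf_norm N (\<lambda>j. f j \<omega>)\<bar>
      / (\<kappa> * (2 * (1 + ln Q) * (1 + ln (real N))) powr (1/r)))) \<partial>M) \<le> 1"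
    unfolding \<epsilon>_def L_def .
qed

lemma orlicz_norm_zero: "orlicz_norm M r (\<lambda>\<omega>. 0) = 0"
proof -
  have *: "orlicz_norm M r (\<lambda>\<omega>. 0) \<le> ennreal e" if "0 < e" for e
    by (rule orlicz_norm_leI) (simp_all add: that phi_def)
  have "orlicz_norm M r (\<lambda>\<omega>. 0) \<le> 0"
    by (rule ennreal_le_epsilon) (simp only: add_0_left *)
  then show ?thesis by simp
qed

text \<open>The scaling parameter \<open>\<kappa> A\<close> degenerates for \<open>A = 0\<close>, where all coefficients vanish.\<close>

lemma sum_estimateI:
  fixes \<gamma> :: "nat \<Rightarrow> 'w \<Rightarrow> 'k::{real_normed_field, second_countable_topology}"
  assumes "prob_space M" and \<kappa>: "0 < \<kappa>" and r: "1 \<le> r" and N: "1 \<le> N" and Q: "1 \<le> Q"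
    and meas[measurable]: "\<And>i. \<gamma> i \<in> borel_measurable M"
    and S: "\<And>K x i. 1 \<le> K \<Longrightarrow> i < K \<Longrightarrow> norm (x i) \<le> S K x"
    and int: "\<And>K x A. 1 \<le> K \<Longrightarrow> 0 < A \<Longrightarrow> S K x \<le> A \<Longrightarrow>
      (\<integral>\<^sup>+\<omega>. ennreal (exp ((norm (\<Sum>i<K. \<gamma> i \<omega> * x i) / (\<kappa> * A)) powr r)) \<partial>M) \<le> ennreal Q"
    and c: "\<kappa> * (2 * (1 + ln Q)) powr (1/r) \<le> c"
  shows "sum_estimate M \<gamma> r S N (ennreal (c * (1 + ln (real N)) powr (1/r)))"
  unfolding sum_estimate_def
proof (intro allI impI)
  fix K :: nat and a :: "nat \<Rightarrow> nat \<Rightarrow> 'k"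
  assume K: "1 \<le> K"
  \<comment> \<open>One scale for all columns: the moment hypothesis admits any upper bound of the
    norm, so the same \<open>A\<close> serves every coordinate.\<close>
  define A where "A = (MAX j\<in>{..<N}. S K (\<lambda>i. a i j))"
  have le: "S K (\<lambda>i. a i j) \<le> A" if "j < N" for j
    unfolding A_def using that by (intro Max_ge) auto
  have "0 \<le> norm (a 0 0)" by simp
  also have "\<dots> \<le> S K (\<lambda>i. a i 0)" using K by (intro S) auto
  also have "\<dots> \<le> A" using N by (intro le) auto
  finally have "0 \<le> A" .
  show "orlicz_norm M r (\<lambda>\<omega>. linf_norm N (\<lambda>j. \<Sum>i<K. \<gamma> i \<omega> * a i j))
      \<le> ennreal (c * (1 + ln (real N)) powr (1/r)) * ennreal A"
  proof (cases "A = 0")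
    case True
    have "a i j = 0" if "i < K" "j < N" for i j
    proof -
      have "norm (a i j) \<le> A"
        using S[OF K that(1), of "\<lambda>i. a i j"] le[OF that(2)] by (rule order.trans)
      then show ?thesis using True by simp
    qed
    then have "linf_norm N (\<lambda>j. \<Sum>i<K. \<gamma> i \<omega> * a i j) = 0" for \<omega>
      using linf_norm_attained[OF N, of "\<lambda>j. \<Sum>i<K. \<gamma> i \<omega> * a i j"] by auto
    then show ?thesis by (simp add: orlicz_norm_zero)
  next
    case False
    with \<open>0 \<le> A\<close> have A: "0 < A" by simp
    have "orlicz_norm M r (\<lambda>\<omega>. linf_norm N (\<lambda>j. \<Sum>i<K. \<gamma> i \<omega> * a i j))
        \<le> ennreal (\<kappa> * A * (2 * (1 + ln Q) * (1 + ln (real N))) powr (1/r))"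
      using \<open>prob_space M\<close> \<kappa> A r N Q int[OF K A le] by (intro orlicz_norm_linf_le) auto
    also have "\<kappa> * A * (2 * (1 + ln Q) * (1 + ln (real N))) powr (1/r)
        = (\<kappa> * (2 * (1 + ln Q)) powr (1/r)) * (1 + ln (real N)) powr (1/r) * A"
      using Q N by (simp add: powr_mult)
    also have "ennreal \<dots> \<le> ennreal (c * (1 + ln (real N)) powr (1/r) * A)"
      using c A by (intro ennreal_leI mult_right_mono) auto
    also have "\<dots> = ennreal (c * (1 + ln (real N)) powr (1/r)) * ennreal A"
      using A by (simp add: ennreal_mult'')
    finally show ?thesis .
  qed
qed

section \<open>The upper estimate for r = 2\<close>

lemma subgaussian_l2_estimate:
  fixes \<gamma> :: "nat \<Rightarrow> 'w \<Rightarrow> complex"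
  assumes "indep_seq M \<gamma>" and sub: "\<And>i. complex_subgaussian_with M (\<gamma> i) \<sigma>"
    and \<sigma>: "0 < \<sigma>" and N: "1 \<le> N"
  shows "sum_estimate M \<gamma> 2 l2_norm N (ennreal (9 * \<sigma> * (1 + ln (real N)) powr (1/2)))"
\<comment> \<open>\<open>Q = 4\<close> is the bound of
  \<open>complex_subgaussian_exp_square\<close>, and the factor 3 absorbs its 8, since 8 <= 3^2. The
  constant 9 is this 3 times another 3, which bounds the square root of 2 (1 + ln 4).\<close>
proof (rule sum_estimateI[where \<kappa> = "3 * \<sigma>" and Q = 4])
  show M: "prob_space M" using assms by (simp add: indep_seq_def)
  interpret prob_space M by fact
  have ind: "indep_vars (\<lambda>_. borel) \<gamma> UNIV" using assms by (simp add: indep_seq_def)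
  then show meas[measurable]: "\<gamma> i \<in> borel_measurable M" for i by (simp add: indep_vars_def2)
  show "norm (x i) \<le> l2_norm K x" if "i < K" for K i and x :: "nat \<Rightarrow> complex"
    unfolding l2_norm_def using that member_le_L2_set[of "{..<K}" i "\<lambda>i. norm (x i)"] by simp
  show "(\<integral>\<^sup>+\<omega>. ennreal (exp ((norm (\<Sum>i<K. \<gamma> i \<omega> * x i) / (3 * \<sigma> * A)) powr 2)) \<partial>M) \<le> ennreal 4"
    if A: "0 < A" and le: "l2_norm K x \<le> A" for K x A
  proof -
    have "complex_subgaussian_with M (\<lambda>\<omega>. \<Sum>i<K. \<gamma> i \<omega> * x i) (\<sigma> * l2_norm K x)"
      unfolding l2_norm_def by (intro complex_subgaussian_sum M ind sub) auto
    then have "complex_subgaussian_with M (\<lambda>\<omega>. \<Sum>i<K. \<gamma> i \<omega> * x i) (\<sigma> * A)"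
      by (rule complex_subgaussian_with_mono) (use le \<sigma> in auto)
    then have "(\<integral>\<^sup>+\<omega>. ennreal (exp ((norm (\<Sum>i<K. \<gamma> i \<omega> * x i))\<^sup>2 / (8 * (\<sigma> * A)\<^sup>2))) \<partial>M) \<le> 4"
      using M A \<sigma> by (intro complex_subgaussian_exp_square) auto
    moreover have "(norm (\<Sum>i<K. \<gamma> i \<omega> * x i) / (3 * \<sigma> * A)) powr 2
        \<le> (norm (\<Sum>i<K. \<gamma> i \<omega> * x i))\<^sup>2 / (8 * (\<sigma> * A)\<^sup>2)" for \<omega>
      using A \<sigma> by (auto simp: power_mult_distrib power_divide intro!: divide_left_mono)
    then have "(\<integral>\<^sup>+\<omega>. ennreal (exp ((norm (\<Sum>i<K. \<gamma> i \<omega> * x i) / (3 * \<sigma> * A)) powr 2)) \<partial>M)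
      \<le> (\<integral>\<^sup>+\<omega>. ennreal (exp ((norm (\<Sum>i<K. \<gamma> i \<omega> * x i))\<^sup>2 / (8 * (\<sigma> * A)\<^sup>2))) \<partial>M)"
      by (intro nn_integral_mono ennreal_leI) simp
    ultimately show ?thesis by simp
  qed
  have "ln (4::real) \<le> 3" using ln_le_minus_one[of "4::real"] by simp
  then have "(2 * (1 + ln 4)) powr (1/2) \<le> (9::real) powr (1/2)" by (intro powr_mono2) auto
  then show "3 * \<sigma> * (2 * (1 + ln 4)) powr (1/2) \<le> 9 * \<sigma>"
    using \<sigma> by (simp add: powr_half_sqrt)
qed (use \<sigma> N in auto)

section \<open>Bounded variables and weak norms\<close>

text \<open>Comparison with the integral of t^(\<alpha> - 1) over (0, m). The induction step is the
  weighted arithmetic-geometric mean inequality for m and b = m + 1, multiplied by b^(\<alpha> -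
  1).\<close>

lemma sum_powr_head_le:
  fixes \<alpha> :: real
  assumes "0 < \<alpha>" "\<alpha> \<le> 1"
  shows "(\<Sum>n<m. real (n + 1) powr (\<alpha> - 1)) \<le> real m powr \<alpha> / \<alpha>"
proof (induction m)
  case (Suc m)
  define b where "b = real m + 1"
  have "\<alpha> * b powr (\<alpha> - 1) + real m powr \<alpha> \<le> b powr \<alpha>"
  proof (cases "m = 0")
    case False
    have "real m powr \<alpha> * b powr (1 - \<alpha>) \<le> \<alpha> * real m + (1 - \<alpha>) * b"
      using assms False by (intro Youngs_inequality_0) (auto simp: b_def)
    also have "\<dots> = b - \<alpha>" by (simp add: b_def algebra_simps)
    finally have "real m powr \<alpha> * b powr (1 - \<alpha>) * b powr (\<alpha> - 1) \<le> (b - \<alpha>) * b powr (\<alpha> - 1)"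
      by (intro mult_right_mono) auto
    also have "(b - \<alpha>) * b powr (\<alpha> - 1) = b powr \<alpha> - \<alpha> * b powr (\<alpha> - 1)"
      by (simp add: left_diff_distrib powr_mult_base b_def)
    also have "real m powr \<alpha> * b powr (1 - \<alpha>) * b powr (\<alpha> - 1) = real m powr \<alpha>"
      by (simp add: mult.assoc b_def flip: powr_add)
    finally show ?thesis by simp
  qed (use assms in \<open>simp add: b_def\<close>)
  with Suc assms show ?case by (simp add: b_def field_simps add.commute)
qed simp

text \<open>Comparison with the integral of t^(-\<beta>) from m on. The terms start at m + 1, so the
  whole sum lies under the graph.\<close>

lemma sum_powr_tail_le:
  fixes \<beta> :: real
  assumes "1 < \<beta>" "1 \<le> m"
  shows "(\<Sum>n\<in>{m..<K}. real (n + 1) powr (- \<beta>)) \<le> real m powr (1 - \<beta>) / (\<beta> - 1)"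
proof (cases "m \<le> K")
  case True
  \<comment> \<open>The subtracted term, the integral beyond \<open>K\<close>, makes the induction
    telescope; its step reduces to 1 + t <= exp t.\<close>
  have "(\<Sum>n\<in>{m..<K}. real (n + 1) powr (- \<beta>)) \<le> (real m powr (1 - \<beta>) - real K powr (1 - \<beta>)) / (\<beta> - 1)"
    using True
  proof (induction K rule: dec_induct)
    case (step k)
    define b where "b = real k + 1"
    have k: "0 < real k" "0 < b" using step assms by (auto simp: b_def)
    have "ln (real k / b) \<le> real k / b - 1" using k by (intro ln_le_minus_one) auto
    then have "1 / b \<le> ln b - ln (real k)" using k by (simp add: ln_div b_def field_simps)
    then have "1 + (\<beta> - 1) * (1 / b) \<le> 1 + (\<beta> - 1) * (ln b - ln (real k))"
      using assms by (intro add_left_mono mult_left_mono) auto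
    also have "\<dots> \<le> exp ((\<beta> - 1) * (ln b - ln (real k)))" by (rule exp_ge_add_one_self)
    finally have "b powr (1 - \<beta>) * (1 + (\<beta> - 1) * (1 / b))
        \<le> b powr (1 - \<beta>) * exp ((\<beta> - 1) * (ln b - ln (real k)))"
      by (intro mult_left_mono) auto
    also have "\<dots> = real k powr (1 - \<beta>)"
      using k by (simp add: powr_def mult_exp_exp algebra_simps)
    also have "b powr (1 - \<beta>) * (1 + (\<beta> - 1) * (1 / b)) = b powr (1 - \<beta>) + (\<beta> - 1) * b powr (- \<beta>)"
      using k by (simp add: powr_diff powr_minus field_simps)
    finally have "(\<beta> - 1) * b powr (- \<beta>) + b powr (1 - \<beta>) \<le> real k powr (1 - \<beta>)" by simp
    with step.IH step.hyps assms show ?case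
      by (simp add: b_def field_simps add.commute sum.atLeastLessThan_Suc)
  qed simp
  also have "\<dots> \<le> real m powr (1 - \<beta>) / (\<beta> - 1)"
    using assms by (intro divide_right_mono) auto
  finally show ?thesis .
qed (use assms in simp)

text \<open>Replaces the sorted list by a permutation of the indices: a list and its sorted version
  have the same multiset. The pointwise decay bound is the form in which the weak norm enters the
  splitting into head and tail.\<close>

lemma weak_lp_norm_rearrange:
  fixes x :: "nat \<Rightarrow> 'k::real_normed_field"
  obtains \<pi> where "bij_betw \<pi> {..<K} {..<K}"
    "\<And>n. n < K \<Longrightarrow> norm (x (\<pi> n)) \<le> weak_lp_norm p K x * real (n + 1) powr (- (1 / p))"
proof -
  define xs where "xs = map (\<lambda>i. norm (x i)) [0..<K]"
  have "mset (decreasing_rearrangement K x) = mset xs"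
    by (simp add: decreasing_rearrangement_def xs_def)
  then obtain \<pi> where \<pi>: "\<pi> permutes {..<length xs}" "permute_list \<pi> xs = decreasing_rearrangement K x"
    by (rule mset_eq_permutation)
  have len: "length xs = K" by (simp add: xs_def)
  show thesis
  proof
    show "bij_betw \<pi> {..<K} {..<K}" using \<pi> len by (simp add: permutes_imp_bij)
    fix n assume n: "n < K"
    then have "\<pi> n < K" using \<pi> len permutes_in_image by fastforce
    then have "decreasing_rearrangement K x ! n = norm (x (\<pi> n))"
      using permute_list_nth[OF \<pi>(1)] n unfolding \<pi>(2)[symmetric] by (simp add: len) (simp add: xs_def)
    moreover have "real (n + 1) powr (1 / p) * (decreasing_rearrangement K x ! n) \<le> weak_lp_norm p K x"
      unfolding weak_lp_norm_def using n by (intro Max_ge) auto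
    ultimately show "norm (x (\<pi> n)) \<le> weak_lp_norm p K x * real (n + 1) powr (- (1 / p))"
      by (simp add: powr_minus field_simps)
  qed
qed

lemma norm_le_weak_lp_norm:
  assumes "0 < p" "i < K"
  shows "norm (x i) \<le> weak_lp_norm p K x"
proof -
  obtain \<pi> where \<pi>: "bij_betw \<pi> {..<K} {..<K}"
    "\<And>n. n < K \<Longrightarrow> norm (x (\<pi> n)) \<le> weak_lp_norm p K x * real (n + 1) powr (- (1 / p))"
    using weak_lp_norm_rearrange[of K x p] by blast
  obtain n where n: "n < K" "\<pi> n = i" using \<pi>(1) \<open>i < K\<close> unfolding bij_betw_def by (metis imageE lessThan_iff)
  have "0 \<le> weak_lp_norm p K x * real (n + 1) powr (- (1 / p))"
    using order.trans[OF norm_ge_zero \<pi>(2)[OF n(1)]] .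
  then have "0 \<le> weak_lp_norm p K x" by (simp add: zero_le_mult_iff)
  moreover have "real (n + 1) powr (- (1 / p)) \<le> 1"
    using assms powr_mono[of "- (1 / p)" 0 "real (n + 1)"] by simp
  ultimately show ?thesis using \<pi>(2)[OF n(1)] n(2) mult_left_le by (smt (verit))
qed

lemma sum_exp_neg_le: "(\<Sum>n<K. exp (- real n)) \<le> 2"
proof -
  \<comment> \<open>The subtracted term lets the induction close; its step amounts to 2 <=
    e.\<close>
  have "(\<Sum>n<K. exp (- real n)) \<le> 2 - 2 * exp (- real K)"
  proof (induction K)
    case (Suc K)
    have "2 * exp (- real (Suc K)) \<le> exp (- real K)"
      using exp_ge_add_one_self[of 1] by (simp add: exp_diff exp_minus field_simps exp_add)
    with Suc show ?case by simp
  qed simp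
  also have "\<dots> \<le> 2" by simp
  finally show ?thesis .
qed

text \<open>
  For every \<open>m\<close> the sum splits into the \<open>m\<close> largest coefficients, bounded by a multiple of
  \<open>m\<^bsup>1/r\<^esup>\<close> because the variables are bounded, and a remainder whose subgaussian constant is a
  multiple of \<open>m\<^bsup>1/r - 1/2\<^esup>\<close>. Hence the random sum exceeds a multiple of \<open>m\<^bsup>1/r\<^esup>\<close> with
  probability \<open>O(exp (- 2 m))\<close>; the weights \<open>W m\<close> express this tail estimate pointwise.
\<close>

lemma subgaussian_weak_exp_moment:
  fixes \<gamma> :: "nat \<Rightarrow> 'w \<Rightarrow> complex"
  assumes "indep_seq M \<gamma>" and sub: "\<And>i. complex_subgaussian_with M (\<gamma> i) \<sigma>"
    and \<sigma>: "0 < \<sigma>" and B: "0 \<le> B" and bnd: "\<And>i. AE \<omega> in M. norm (\<gamma> i \<omega>) \<le> B"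
    and r: "2 < r" and A: "0 < A" and x: "weak_lp_norm (conjugate_exponent r) K x \<le> A"
    and D: "D = B * r + 4 * \<sigma> / sqrt (1 - 2 / r)"
  shows "(\<integral>\<^sup>+\<omega>. ennreal (exp ((norm (\<Sum>i<K. \<gamma> i \<omega> * x i) / (D * A)) powr r)) \<partial>M) \<le> ennreal 11"
proof -
  have M: "prob_space M" using assms by (simp add: indep_seq_def)
  interpret prob_space M by fact
  have ind: "indep_vars (\<lambda>_. borel) \<gamma> UNIV" using assms by (simp add: indep_seq_def)
  then have [measurable]: "\<gamma> i \<in> borel_measurable M" for i by (simp add: indep_vars_def2)
  define \<alpha> where "\<alpha> = 1 / r"
  have \<alpha>: "0 < \<alpha>" "\<alpha> < 1 / 2" using r by (auto simp: \<alpha>_def field_simps)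
  have conj: "1 / conjugate_exponent r = 1 - \<alpha>"
    using conjugate_exponent[of r] r by (simp add: \<alpha>_def)
  \<comment> \<open>\<open>D\<close> is the head constant B / \<alpha> plus \<open>T\<close>, so an
    excess of the sum over D A m^\<alpha> forces the tail above T A m^\<alpha>. The 4 makes the
    square of that threshold equal to 2m times 8 (\<tau> m)^2, hence \<open>W m\<close> at least exp
    (2m).\<close>
  define T where "T = 4 * \<sigma> / sqrt (1 - 2 * \<alpha>)"
  have T: "0 < T" using \<alpha> \<sigma> by (simp add: T_def)
  have D': "D = B / \<alpha> + T" unfolding D \<alpha>_def T_def using r by simp
  have Dpos: "0 < D" unfolding D' using T B \<alpha> by (simp add: add_nonneg_pos)
  obtain \<pi> where \<pi>: "bij_betw \<pi> {..<K} {..<K}"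
    and le0: "\<And>n. n < K \<Longrightarrow> norm (x (\<pi> n)) \<le> weak_lp_norm (conjugate_exponent r) K x
      * real (n + 1) powr (- (1 / conjugate_exponent r))"
    using weak_lp_norm_rearrange[of K x "conjugate_exponent r"] by blast
  have le: "norm (x (\<pi> n)) \<le> A * real (n + 1) powr (\<alpha> - 1)" if "n < K" for n
  proof -
    have "norm (x (\<pi> n)) \<le> weak_lp_norm (conjugate_exponent r) K x * real (n + 1) powr (\<alpha> - 1)"
      using le0[OF that] by (simp add: conj)
    also have "\<dots> \<le> A * real (n + 1) powr (\<alpha> - 1)" using x by (intro mult_right_mono) auto
    finally show ?thesis .
  qed
  have inj: "inj_on \<pi> {m..<K}" for m
    using \<pi> by (auto simp: bij_betw_def intro: inj_on_subset)
  define f where "f \<omega> = (\<Sum>i<K. \<gamma> i \<omega> * x i)" for \<omega>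
  define v where "v m \<omega> = (\<Sum>i\<in>\<pi> ` {m..<K}. \<gamma> i \<omega> * x i)" for m \<omega>
  have [measurable]: "f \<in> borel_measurable M" "v m \<in> borel_measurable M" for m
    unfolding f_def v_def by measurable
  \<comment> \<open>Bounds the subgaussian parameter of the tail \<open>v m\<close>: the squared
    coefficients decay with exponent 2 - 2 \<alpha>, which exceeds 1 precisely because r >
    2.\<close>
  define \<tau> where "\<tau> m = \<sigma> * A / sqrt (1 - 2 * \<alpha>) * real m powr (\<alpha> - 1/2)" for m :: nat
  define W where "W m \<omega> = exp ((norm (v m \<omega>))\<^sup>2 / (8 * (\<tau> m)\<^sup>2))" for m \<omega>
  have \<tau>: "0 < \<tau> m" if "1 \<le> m" for m using that \<sigma> A \<alpha> by (simp add: \<tau>_def)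
  have W_int: "(\<integral>\<^sup>+\<omega>. ennreal (W m \<omega>) \<partial>M) \<le> 4" if m: "1 \<le> m" for m
  proof -
    have "(\<Sum>i\<in>\<pi> ` {m..<K}. (norm (x i))\<^sup>2) = (\<Sum>n\<in>{m..<K}. (norm (x (\<pi> n)))\<^sup>2)"
      using inj by (simp add: sum.reindex)
    also have "\<dots> \<le> (\<Sum>n\<in>{m..<K}. A\<^sup>2 * real (n + 1) powr (- (2 - 2 * \<alpha>)))"
    proof (rule sum_mono)
      fix n assume "n \<in> {m..<K}"
      then have "(norm (x (\<pi> n)))\<^sup>2 \<le> (A * real (n + 1) powr (\<alpha> - 1))\<^sup>2"
        using le by (intro power_mono) auto
      then show "(norm (x (\<pi> n)))\<^sup>2 \<le> A\<^sup>2 * real (n + 1) powr (- (2 - 2 * \<alpha>))"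
        by (simp add: power_mult_distrib powr_power algebra_simps)
    qed
    also have "\<dots> = A\<^sup>2 * (\<Sum>n\<in>{m..<K}. real (n + 1) powr (- (2 - 2 * \<alpha>)))"
      by (simp only: sum_distrib_left)
    also have "\<dots> \<le> A\<^sup>2 * (real m powr (1 - (2 - 2 * \<alpha>)) / ((2 - 2 * \<alpha>) - 1))"
      using \<alpha> m by (intro mult_left_mono sum_powr_tail_le) auto
    finally have "\<sigma>\<^sup>2 * (\<Sum>i\<in>\<pi> ` {m..<K}. (norm (x i))\<^sup>2)
        \<le> \<sigma>\<^sup>2 * (A\<^sup>2 * (real m powr (1 - (2 - 2 * \<alpha>)) / ((2 - 2 * \<alpha>) - 1)))"
      by (intro mult_left_mono) auto
    also have "\<dots> = (\<tau> m)\<^sup>2"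
    proof -
      have "(real m powr (\<alpha> - 1/2))\<^sup>2 = real m powr (2 * \<alpha> - 1)"
        by (simp add: power2_eq_square flip: powr_add)
      then show ?thesis
        using \<alpha> by (simp add: \<tau>_def power_mult_distrib power_divide)
    qed
    finally have "(\<sigma> * L2_set (\<lambda>i. norm (x i)) (\<pi> ` {m..<K}))\<^sup>2 \<le> (\<tau> m)\<^sup>2"
      by (simp add: L2_set_def power_mult_distrib sum_nonneg)
    then have "\<sigma> * L2_set (\<lambda>i. norm (x i)) (\<pi> ` {m..<K}) \<le> \<tau> m"
      using \<tau>[OF m] by (rule power2_le_imp_le[OF _ less_imp_le])
    moreover have "complex_subgaussian_with M (v m) (\<sigma> * L2_set (\<lambda>i. norm (x i)) (\<pi> ` {m..<K}))"
      unfolding v_def by (intro complex_subgaussian_sum M ind sub) auto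
    ultimately have "complex_subgaussian_with M (v m) (\<tau> m)"
      by (metis complex_subgaussian_with_mono)
    then show ?thesis unfolding W_def using M \<tau>[OF m] by (intro complex_subgaussian_exp_square) auto
  qed
  have split: "norm (f \<omega>) \<le> B / \<alpha> * A * real m powr \<alpha> + norm (v m \<omega>)"
    if b: "\<And>i. norm (\<gamma> i \<omega>) \<le> B" and m: "m \<le> K" for m \<omega>
  proof -
    have "f \<omega> = (\<Sum>n<K. \<gamma> (\<pi> n) \<omega> * x (\<pi> n))"
      unfolding f_def using sum.reindex_bij_betw[OF \<pi>, of "\<lambda>i. \<gamma> i \<omega> * x i"] by simp
    also have "\<dots> = (\<Sum>n<m. \<gamma> (\<pi> n) \<omega> * x (\<pi> n)) + (\<Sum>n\<in>{m..<K}. \<gamma> (\<pi> n) \<omega> * x (\<pi> n))"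
      using m sum.atLeastLessThan_concat[of 0 m K "\<lambda>n. \<gamma> (\<pi> n) \<omega> * x (\<pi> n)"]
      by (simp add: lessThan_atLeast0)
    also have "(\<Sum>n\<in>{m..<K}. \<gamma> (\<pi> n) \<omega> * x (\<pi> n)) = v m \<omega>"
      unfolding v_def using inj by (simp add: sum.reindex)
    finally have "norm (f \<omega>) \<le> (\<Sum>n<m. norm (\<gamma> (\<pi> n) \<omega> * x (\<pi> n))) + norm (v m \<omega>)"
      by (simp only: norm_triangle_mono[OF norm_sum order.refl])
    also have "(\<Sum>n<m. norm (\<gamma> (\<pi> n) \<omega> * x (\<pi> n))) \<le> (\<Sum>n<m. B * (A * real (n + 1) powr (\<alpha> - 1)))"
      unfolding norm_mult using m B by (intro sum_mono mult_mono b le) auto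
    also have "\<dots> = B * A * (\<Sum>n<m. real (n + 1) powr (\<alpha> - 1))"
      by (simp only: sum_distrib_left mult.assoc)
    also have "\<dots> \<le> B * A * (real m powr \<alpha> / \<alpha>)"
      using A B \<alpha> by (intro mult_left_mono sum_powr_head_le) auto
    finally show ?thesis by simp
  qed
  define Y where "Y \<omega> = (norm (f \<omega>) / (D * A)) powr r" for \<omega>
  have Y_gt: "D * A * real m powr \<alpha> < norm (f \<omega>)" if "real m < Y \<omega>" for m \<omega>
  proof -
    have "real m powr \<alpha> < Y \<omega> powr \<alpha>" using that \<alpha> by (intro powr_less_mono2) auto
    also have "\<dots> = norm (f \<omega>) / (D * A)" using r A Dpos by (simp add: Y_def powr_powr \<alpha>_def)
    finally show ?thesis using A Dpos by (simp add: field_simps)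
  qed
  have pointwise: "exp (Y \<omega>) \<le> 3 + (\<Sum>n<K. exp (- real n) * W (n + 1) \<omega>)"
    if b: "\<And>i. norm (\<gamma> i \<omega>) \<le> B" for \<omega>
  proof (cases "Y \<omega> \<le> 1")
    case True
    then have "exp (Y \<omega>) \<le> exp 1" by simp
    also have "\<dots> \<le> 3" by (rule exp_le)
    finally show ?thesis by (simp add: add_increasing2 sum_nonneg W_def)
  next
    case False
    \<comment> \<open>The largest integer strictly below \<open>Y \<omega>\<close>: strictness is
      what \<open>Y_gt\<close> asks for, and \<open>Y \<omega>\<close> is still at most m +
      1.\<close>
    define m where "m = nat \<lceil>Y \<omega>\<rceil> - 1"
    have m: "1 \<le> m" "real m < Y \<omega>" "Y \<omega> \<le> real m + 1"
      using False unfolding m_def by linarith+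
    \<comment> \<open>At level \<open>K\<close> the tail is empty and the head bound alone gives Y
      <= K. Hence m < K, so that \<open>split\<close> applies at \<open>m\<close> and the summand of
      index m - 1 is present.\<close>
    have "v K \<omega> = 0" by (simp add: v_def)
    then have "norm (f \<omega>) \<le> B / \<alpha> * A * real K powr \<alpha>"
      using split[OF b, of K] by simp
    also have "\<dots> \<le> D * A * real K powr \<alpha>"
      unfolding D' using A T by (intro mult_right_mono) auto
    finally have "\<not> real K < Y \<omega>" using Y_gt[of K \<omega>] by linarith
    then have mK: "m < K" using m by linarith
    have "D * A * real m powr \<alpha> < B / \<alpha> * A * real m powr \<alpha> + norm (v m \<omega>)"
      using Y_gt[OF m(2)] split[OF b, of m] mK by linarith
    then have "T * A * real m powr \<alpha> < norm (v m \<omega>)"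
      by (simp add: D' algebra_simps)
    then have "(T * A * real m powr \<alpha>)\<^sup>2 \<le> (norm (v m \<omega>))\<^sup>2"
      using T A by (intro power_mono) auto
    moreover have "(T * A * real m powr \<alpha>)\<^sup>2 = 2 * real m * (8 * (\<tau> m)\<^sup>2)"
    proof -
      have "(real m powr \<alpha>)\<^sup>2 = real m powr (1 + ((\<alpha> - 1/2) + (\<alpha> - 1/2)))"
        by (simp add: power2_eq_square flip: powr_add)
      also have "\<dots> = real m * (real m powr (\<alpha> - 1/2))\<^sup>2"
        using m by (simp only: powr_add power2_eq_square) simp
      finally show ?thesis
        using \<alpha> by (simp add: T_def \<tau>_def power_mult_distrib power_divide)
    qed
    ultimately have "2 * real m \<le> (norm (v m \<omega>))\<^sup>2 / (8 * (\<tau> m)\<^sup>2)"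
      using \<tau>[OF m(1)] by (simp add: pos_le_divide_eq)
    then have "exp (2 * real m) \<le> W m \<omega>" by (simp add: W_def)
    \<comment> \<open>Since Y <= m + 1, the surplus in exp (2m) leaves the summable weight exp (-(m
      - 1)). The shift to index m - 1 avoids \<open>W 0\<close>, where \<open>\<tau> 0\<close> is
      0.\<close>
    have "exp (Y \<omega>) \<le> exp (- real (m - 1) + 2 * real m)"
      using m by (simp add: of_nat_diff)
    also have "\<dots> = exp (- real (m - 1)) * exp (2 * real m)" by (rule exp_add)
    also have "\<dots> \<le> exp (- real (m - 1)) * W ((m - 1) + 1) \<omega>"
      using m \<open>exp (2 * real m) \<le> W m \<omega>\<close> by simp
    also have "\<dots> \<le> (\<Sum>n<K. exp (- real n) * W (n + 1) \<omega>)"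
      using mK by (intro member_le_sum) (auto simp: W_def)
    finally show ?thesis by simp
  qed
  have "AE \<omega> in M. \<forall>i. norm (\<gamma> i \<omega>) \<le> B" using bnd by (simp add: AE_all_countable)
  then have "(\<integral>\<^sup>+\<omega>. ennreal (exp (Y \<omega>)) \<partial>M)
    \<le> (\<integral>\<^sup>+\<omega>. 3 + (\<Sum>n<K. ennreal (exp (- real n)) * ennreal (W (n + 1) \<omega>)) \<partial>M)"
  proof (intro nn_integral_mono_AE, eventually_elim)
    fix \<omega> assume "\<forall>i. norm (\<gamma> i \<omega>) \<le> B"
    then have "ennreal (exp (Y \<omega>)) \<le> ennreal (3 + (\<Sum>n<K. exp (- real n) * W (n + 1) \<omega>))"
      by (intro ennreal_leI pointwise) auto
    also have "\<dots> = 3 + (\<Sum>n<K. ennreal (exp (- real n)) * ennreal (W (n + 1) \<omega>))"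
      by (simp add: W_def sum_nonneg ennreal_plus flip: sum_ennreal ennreal_mult)
    finally show "ennreal (exp (Y \<omega>)) \<le> 3 + (\<Sum>n<K. ennreal (exp (- real n)) * ennreal (W (n + 1) \<omega>))" .
  qed
  also have "\<dots> = 3 + (\<Sum>n<K. ennreal (exp (- real n)) * (\<integral>\<^sup>+\<omega>. ennreal (W (n + 1) \<omega>) \<partial>M))"
    unfolding W_def by (simp add: nn_integral_add nn_integral_cmult nn_integral_sum emeasure_space_1)
  also have "\<dots> \<le> 3 + (\<Sum>n<K. ennreal (exp (- real n)) * 4)"
    by (intro add_left_mono sum_mono mult_left_mono W_int) auto
  also have "\<dots> = ennreal (3 + (\<Sum>n<K. exp (- real n)) * 4)"
    by (simp add: sum_nonneg ennreal_plus ennreal_mult flip: sum_ennreal sum_distrib_right)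
  \<comment> \<open>11 = 3 + 2 * 4: the region Y <= 1 contributes 3 >= e, the weights sum to at most
    2, and each \<open>W\<close> has expectation at most 4.\<close>
  also have "\<dots> \<le> ennreal 11"
    using sum_exp_neg_le[of K] by (intro ennreal_leI) linarith
  finally show ?thesis unfolding Y_def f_def .
qed

section \<open>The upper estimate for r > 2\<close>

text \<open>The scale \<open>D\<close> of the moment bound times the factor that
  \<open>sum_estimateI\<close> produces for Q = 11. The singularity at r = 2 reflects the divergence
  of the tail's l_2-sum there.\<close>

definition weak_constant :: "real \<Rightarrow> real \<Rightarrow> real \<Rightarrow> real" where
  "weak_constant r \<sigma> B = (B * r + 4 * \<sigma> / sqrt (1 - 2 / r)) * (2 * (1 + ln 11)) powr (1/r)"

lemma weak_constant_pos:
  assumes "0 \<le> B" "0 < \<sigma>" "2 < r"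
  shows "0 < weak_constant r \<sigma> B"
proof -
  have "0 < B * r + 4 * \<sigma> / sqrt (1 - 2 / r)"
    using assms by (intro add_nonneg_pos) auto
  moreover have "0 < 1 + ln (11::real)" by (simp add: add_pos_nonneg)
  ultimately show ?thesis by (simp add: weak_constant_def)
qed

lemma subgaussian_weak_estimate:
  fixes \<gamma> :: "nat \<Rightarrow> 'w \<Rightarrow> complex"
  assumes "indep_seq M \<gamma>" and sub: "\<And>i. complex_subgaussian_with M (\<gamma> i) \<sigma>"
    and \<sigma>: "0 < \<sigma>" and B: "0 \<le> B" and bnd: "\<And>i. AE \<omega> in M. norm (\<gamma> i \<omega>) \<le> B"
    and r: "2 < r" and N: "1 \<le> N"
  shows "sum_estimate M \<gamma> r (weak_lp_norm (conjugate_exponent r)) N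
    (ennreal (weak_constant r \<sigma> B * (1 + ln (real N)) powr (1/r)))"
  unfolding weak_constant_def
proof (rule sum_estimateI[where Q = 11, OF _ _ _ N _ _ _ _ order.refl])
  show M: "prob_space M" using assms by (simp add: indep_seq_def)
  interpret prob_space M by fact
  have "indep_vars (\<lambda>_. borel) \<gamma> UNIV" using assms by (simp add: indep_seq_def)
  then show meas[measurable]: "\<gamma> i \<in> borel_measurable M" for i by (simp add: indep_vars_def2)
  show "0 < B * r + 4 * \<sigma> / sqrt (1 - 2 / r)"
    using B \<sigma> r by (intro add_nonneg_pos) auto
  show "norm (x i) \<le> weak_lp_norm (conjugate_exponent r) K x" if "i < K" for x :: "nat \<Rightarrow> complex" and i K
    using that r by (intro norm_le_weak_lp_norm) (auto simp: conjugate_exponent_def)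
qed (use r subgaussian_weak_exp_moment[OF assms(1) sub \<sigma> B bnd r] in auto)

section \<open>Real and complex sequences\<close>

text \<open>Tests the complex estimate on real coefficients. The compatibility of the two norms
  holds in the applications because only moduli enter them.\<close>

lemma sum_estimate_of_real:
  assumes "sum_estimate M (\<lambda>i \<omega>. complex_of_real (\<gamma> i \<omega>)) r S' N c"
    and S: "\<And>K x. S' K (\<lambda>i. complex_of_real (x i)) = S K x"
  shows "sum_estimate M \<gamma> r S N c"
  unfolding sum_estimate_def
proof (intro allI impI)
  fix K :: nat and a :: "nat \<Rightarrow> nat \<Rightarrow> real"
  assume "1 \<le> K"
  then have "orlicz_norm M r (\<lambda>\<omega>. linf_norm N (\<lambda>j. \<Sum>i<K. complex_of_real (\<gamma> i \<omega>) * complex_of_real (a i j)))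
      \<le> c * ennreal (MAX j\<in>{..<N}. S' K (\<lambda>i. complex_of_real (a i j)))"
    by (rule assms(1)[unfolded sum_estimate_def, rule_format])
  moreover have "linf_norm N (\<lambda>j. \<Sum>i<K. complex_of_real (\<gamma> i \<omega>) * complex_of_real (a i j))
      = linf_norm N (\<lambda>j. \<Sum>i<K. \<gamma> i \<omega> * a i j)" for \<omega>
    unfolding linf_norm_def of_real_mult[symmetric] of_real_sum[symmetric] norm_of_real by simp
  ultimately show "orlicz_norm M r (\<lambda>\<omega>. linf_norm N (\<lambda>j. \<Sum>i<K. \<gamma> i \<omega> * a i j))
      \<le> c * ennreal (MAX j\<in>{..<N}. S K (\<lambda>i. a i j))"
    by (simp add: S)
qed

lemma l2_norm_of_real: "l2_norm K (\<lambda>i. complex_of_real (x i)) = l2_norm K x"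
  by (simp add: l2_norm_def)

lemma weak_lp_norm_of_real: "weak_lp_norm p K (\<lambda>i. complex_of_real (x i)) = weak_lp_norm p K x"
  by (simp add: weak_lp_norm_def decreasing_rearrangement_def)

lemma best_constant_of_real_ge:
  "best_constant M \<gamma> N r \<le> best_constant M (\<lambda>i \<omega>. complex_of_real (\<gamma> i \<omega>)) N r"
  unfolding best_constant_def
  by (rule Inf_superset_mono)
     (auto intro!: sum_estimate_of_real simp: l2_norm_of_real weak_lp_norm_of_real)

lemma indep_seq_of_real:
  assumes "indep_seq M \<gamma>"
  shows "indep_seq M (\<lambda>i \<omega>. complex_of_real (\<gamma> i \<omega>))"
proof -
  interpret prob_space M using assms by (simp add: indep_seq_def)
  have "indep_vars (\<lambda>_. borel) \<gamma> UNIV" using assms by (simp add: indep_seq_def)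
  then have "indep_vars (\<lambda>_. borel) (\<lambda>i \<omega>. complex_of_real (\<gamma> i \<omega>)) UNIV"
    by (rule indep_vars_compose2) auto
  then show ?thesis using assms by (simp add: indep_seq_def)
qed

lemma indep_seq_measurable: "indep_seq M \<gamma> \<Longrightarrow> \<gamma> i \<in> borel_measurable M"
  by (auto simp: indep_seq_def prob_space.indep_vars_def2)

lemma complex_subgaussian_with_of_real:
  assumes "real_subgaussian_with M f s"
  shows "complex_subgaussian_with M (\<lambda>\<omega>. complex_of_real (f \<omega>)) s"
  unfolding complex_subgaussian_with_def
proof (intro conjI allI)
  show "0 \<le> s" using assms by (simp add: real_subgaussian_with_def)
  fix z :: complex
  have "(\<integral>\<^sup>+\<omega>. ennreal (exp (Re z * f \<omega>)) \<partial>M) \<le> ennreal (exp (s\<^sup>2 * (Re z)\<^sup>2 / 2))"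
    using assms by (simp add: real_subgaussian_with_def)
  also have "\<dots> \<le> ennreal (exp (s\<^sup>2 * (norm z)\<^sup>2 / 2))"
    by (simp add: cmod_power2 mult_left_mono ennreal_leI)
  finally show "(\<integral>\<^sup>+\<omega>. ennreal (exp (Re (z * complex_of_real (f \<omega>)))) \<partial>M)
      \<le> ennreal (exp (s\<^sup>2 * (norm z)\<^sup>2 / 2))" by simp
qed

text \<open>The infimum defining sg is not known to be attained here, so a strictly larger parameter
  is taken. Adding 1 also makes it positive when \<open>s\<close> is 0, and the modulus keeps the
  resulting constant positive for every real \<open>s\<close>.\<close>

lemma complex_subgaussian_seqD:
  assumes "complex_subgaussian_seq M \<gamma> s"
  shows "indep_seq M \<gamma>" "complex_subgaussian_with M (\<gamma> i) (\<bar>s\<bar> + 1)"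
proof -
  show "indep_seq M \<gamma>" using assms by (simp add: complex_subgaussian_seq_def)
  have "complex_sg M (\<gamma> i) \<le> s"
    using assms by (auto simp: complex_subgaussian_seq_def intro: cSUP_upper)
  then have less: "Inf {t. complex_subgaussian_with M (\<gamma> i) t} < \<bar>s\<bar> + 1"
    by (simp add: complex_sg_def)
  have "{t. complex_subgaussian_with M (\<gamma> i) t} \<noteq> {}"
    using assms by (auto simp: complex_subgaussian_seq_def complex_subgaussian_def)
  from cInf_lessD[OF this less] obtain t where "complex_subgaussian_with M (\<gamma> i) t" "t < \<bar>s\<bar> + 1"
    by auto
  then show "complex_subgaussian_with M (\<gamma> i) (\<bar>s\<bar> + 1)"
    by (rule complex_subgaussian_with_mono[OF _ less_imp_le])
qed

lemma real_subgaussian_seqD: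
  assumes "real_subgaussian_seq M \<gamma> s"
  shows "indep_seq M (\<lambda>i \<omega>. complex_of_real (\<gamma> i \<omega>))"
    "complex_subgaussian_with M (\<lambda>\<omega>. complex_of_real (\<gamma> i \<omega>)) (\<bar>s\<bar> + 1)"
proof -
  show "indep_seq M (\<lambda>i \<omega>. complex_of_real (\<gamma> i \<omega>))"
    using assms by (simp add: real_subgaussian_seq_def indep_seq_of_real)
  have "real_sg M (\<gamma> i) \<le> s"
    using assms by (auto simp: real_subgaussian_seq_def intro: cSUP_upper)
  then have less: "Inf {t. real_subgaussian_with M (\<gamma> i) t} < \<bar>s\<bar> + 1"
    by (simp add: real_sg_def)
  have "{t. real_subgaussian_with M (\<gamma> i) t} \<noteq> {}"
    using assms by (auto simp: real_subgaussian_seq_def real_subgaussian_def)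
  from cInf_lessD[OF this less] obtain t where "real_subgaussian_with M (\<gamma> i) t" "t < \<bar>s\<bar> + 1"
    by auto
  then show "complex_subgaussian_with M (\<lambda>\<omega>. complex_of_real (\<gamma> i \<omega>)) (\<bar>s\<bar> + 1)"
    by (rule complex_subgaussian_with_mono[OF complex_subgaussian_with_of_real less_imp_le])
qed

lemma sup_Linf_norm_AE:
  assumes "sup_Linf_norm M \<gamma> = ereal B"
  shows "AE \<omega> in M. norm (\<gamma> i \<omega>) \<le> B"
proof -
  have le: "esssup M (\<lambda>\<omega>. ereal (norm (\<gamma> i \<omega>))) \<le> ereal B"
    unfolding assms[symmetric] sup_Linf_norm_def by (intro SUP_upper) auto
  from esssup_AE[of "\<lambda>\<omega>. ereal (norm (\<gamma> i \<omega>))" M] show ?thesis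
  proof eventually_elim
    case (elim \<omega>)
    then have "ereal (norm (\<gamma> i \<omega>)) \<le> ereal B" using le by (rule order.trans)
    then show ?case by simp
  qed
qed

lemma complex_seq_l2_estimate:
  assumes "complex_subgaussian_seq M \<gamma> s" "1 \<le> N"
  shows "sum_estimate M \<gamma> 2 l2_norm N (ennreal (9 * (\<bar>s\<bar> + 1) * (1 + ln (real N)) powr (1/2)))"
  by (rule subgaussian_l2_estimate[OF complex_subgaussian_seqD[OF assms(1)] _ assms(2)]) simp

lemma real_seq_l2_estimate:
  assumes "real_subgaussian_seq M \<gamma> s" "1 \<le> N"
  shows "sum_estimate M (\<lambda>i \<omega>. complex_of_real (\<gamma> i \<omega>)) 2 l2_norm N
      (ennreal (9 * (\<bar>s\<bar> + 1) * (1 + ln (real N)) powr (1/2)))" (is ?C)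
    and "sum_estimate M \<gamma> 2 l2_norm N (ennreal (9 * (\<bar>s\<bar> + 1) * (1 + ln (real N)) powr (1/2)))"
proof -
  show ?C
    by (rule subgaussian_l2_estimate[OF real_subgaussian_seqD[OF assms(1)] _ assms(2)]) simp
  then show "sum_estimate M \<gamma> 2 l2_norm N (ennreal (9 * (\<bar>s\<bar> + 1) * (1 + ln (real N)) powr (1/2)))"
    by (rule sum_estimate_of_real) (rule l2_norm_of_real)
qed

lemma complex_seq_weak_estimate:
  assumes "complex_subgaussian_seq M \<gamma> s" "sup_Linf_norm M \<gamma> = ereal B" "2 < r" "1 \<le> N"
  shows "sum_estimate M \<gamma> r (weak_lp_norm (conjugate_exponent r)) N
    (ennreal (weak_constant r (\<bar>s\<bar> + 1) \<bar>B\<bar> * (1 + ln (real N)) powr (1/r)))"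
proof (rule subgaussian_weak_estimate[OF complex_subgaussian_seqD[OF assms(1)]])
  show "AE \<omega> in M. norm (\<gamma> i \<omega>) \<le> \<bar>B\<bar>" for i
    using sup_Linf_norm_AE[OF assms(2), of i] by eventually_elim simp
qed (use assms in auto)

lemma real_seq_weak_estimate:
  assumes "real_subgaussian_seq M \<gamma> s" "sup_Linf_norm M \<gamma> = ereal B" "2 < r" "1 \<le> N"
  shows "sum_estimate M (\<lambda>i \<omega>. complex_of_real (\<gamma> i \<omega>)) r (weak_lp_norm (conjugate_exponent r)) N
      (ennreal (weak_constant r (\<bar>s\<bar> + 1) \<bar>B\<bar> * (1 + ln (real N)) powr (1/r)))" (is ?C)
    and "sum_estimate M \<gamma> r (weak_lp_norm (conjugate_exponent r)) N
      (ennreal (weak_constant r (\<bar>s\<bar> + 1) \<bar>B\<bar> * (1 + ln (real N)) powr (1/r)))"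
proof -
  show ?C
  proof (rule subgaussian_weak_estimate[OF real_subgaussian_seqD[OF assms(1)]])
    show "AE \<omega> in M. norm (complex_of_real (\<gamma> i \<omega>)) \<le> \<bar>B\<bar>" for i
      using sup_Linf_norm_AE[OF assms(2), of i] by eventually_elim simp
  qed (use assms in auto)
  then show "sum_estimate M \<gamma> r (weak_lp_norm (conjugate_exponent r)) N
      (ennreal (weak_constant r (\<bar>s\<bar> + 1) \<bar>B\<bar> * (1 + ln (real N)) powr (1/r)))"
    by (rule sum_estimate_of_real) (rule weak_lp_norm_of_real)
qed

section \<open>Rademacher, Steinhaus and Gaussian variables\<close>

text \<open>Hoeffding's lemma on an interval of length 2c, where (2c)^2 / 8 = c^2 / 2. It is applied
  for positive parameters; negative ones are reached by passing to -X.\<close>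

lemma real_subgaussian_bounded:
  assumes "prob_space M" and [measurable]: "X \<in> borel_measurable M"
    and bnd: "AE \<omega> in M. \<bar>X \<omega>\<bar> \<le> c" and mean: "(\<integral>\<omega>. X \<omega> \<partial>M) = 0" and "0 \<le> c"
  shows "real_subgaussian_with M X c"
  unfolding real_subgaussian_with_def
proof (intro conjI allI)
  interpret prob_space M by fact
  have pos: "(\<integral>\<^sup>+\<omega>. ennreal (exp (l * Z \<omega>)) \<partial>M) \<le> ennreal (exp (c\<^sup>2 * l\<^sup>2 / 2))"
    if [measurable]: "Z \<in> borel_measurable M" and "AE \<omega> in M. \<bar>Z \<omega>\<bar> \<le> c" "(\<integral>\<omega>. Z \<omega> \<partial>M) = 0" "0 < l"
    for Z l
  proof -
    have AE: "AE \<omega> in M. Z \<omega> \<in> {- c..c}" using that(2) by eventually_elim auto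
    interpret interval_bounded_random_variable M Z "- c" c by unfold_locales (fact that(1) AE)+
    show ?thesis
      using Hoeffdings_lemma_nn_integral_0[OF that(4,3)] by (simp add: power2_eq_square mult_ac)
  qed
  fix l :: real
  show "(\<integral>\<^sup>+\<omega>. ennreal (exp (l * X \<omega>)) \<partial>M) \<le> ennreal (exp (c\<^sup>2 * l\<^sup>2 / 2))"
  proof (cases l "0::real" rule: linorder_cases)
    case less
    then show ?thesis using pos[of "\<lambda>\<omega>. - X \<omega>" "- l"] bnd mean by simp
  qed (use pos[of X l] bnd mean in \<open>auto simp: emeasure_space_1\<close>)
qed fact

lemma rademacher_seqD:
  assumes "rademacher_seq M \<gamma>"
  shows "AE \<omega> in M. \<bar>\<gamma> i \<omega>\<bar> = 1" "real_subgaussian_with M (\<gamma> i) 1"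
proof -
  have ind: "indep_seq M \<gamma>" using assms by (simp add: rademacher_seq_def)
  then interpret prob_space M by (simp add: indep_seq_def)
  have [measurable]: "\<gamma> i \<in> borel_measurable M" using ind by (rule indep_seq_measurable)
  define P where "P = {\<omega> \<in> space M. \<gamma> i \<omega> = 1}"
  define Q where "Q = {\<omega> \<in> space M. \<gamma> i \<omega> = -1}"
  have [measurable]: "P \<in> sets M" "Q \<in> sets M" unfolding P_def Q_def by measurable
  have PQ: "prob P = 1/2" "prob Q = 1/2" using assms by (auto simp: rademacher_seq_def P_def Q_def)
  have "prob (P \<union> Q) = prob P + prob Q"
    by (rule finite_measure_Union) (auto simp: P_def Q_def)
  \<comment> \<open>The definition prescribes only the masses of the values 1 and -1; as they add up
    to 1, almost every value is one of the two.\<close>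
  then have AE: "AE \<omega> in M. \<omega> \<in> P \<union> Q" using PQ by (intro AE_prob_1) simp
  then have eq: "AE \<omega> in M. \<gamma> i \<omega> = indicator P \<omega> - indicator Q \<omega>"
    by eventually_elim (auto simp: P_def Q_def indicator_def)
  from AE have abs: "AE \<omega> in M. \<bar>\<gamma> i \<omega>\<bar> = 1"
    by eventually_elim (auto simp: P_def Q_def)
  show "AE \<omega> in M. \<bar>\<gamma> i \<omega>\<bar> = 1" by fact
  have "(\<integral>\<omega>. \<gamma> i \<omega> \<partial>M) = (\<integral>\<omega>. indicator P \<omega> - indicator Q \<omega> \<partial>M)"
    using eq by (intro integral_cong_AE) auto
  also have "\<dots> = 0" using PQ by (subst Bochner_Integration.integral_diff) (auto simp: less_top[symmetric])
  finally show "real_subgaussian_with M (\<gamma> i) 1"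
    using abs by (intro real_subgaussian_bounded prob_space_axioms) (auto elim!: eventually_mono)
qed

lemma steinhaus_seqD:
  assumes "steinhaus_seq M \<gamma>"
  shows "AE \<omega> in M. norm (\<gamma> i \<omega>) = 1" "complex_subgaussian_with M (\<gamma> i) 1"
proof -
  have ind: "indep_seq M \<gamma>" using assms by (simp add: steinhaus_seq_def)
  then interpret prob_space M by (simp add: indep_seq_def)
  have [measurable]: "\<gamma> i \<in> borel_measurable M" using ind by (rule indep_seq_measurable)
  define U where "U = uniform_measure lborel {0..1::real}"
  have U: "U = density lborel (\<lambda>t. ennreal (indicator {0..1} t))"
    by (simp add: U_def uniform_measure_def ennreal_indicator divide_ennreal_def)
  have [measurable_cong]: "sets U = sets borel" by (simp add: U)
  have d: "distr M borel (\<gamma> i) = distr U borel (\<lambda>t. cis (2 * pi * t))"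
    using assms by (simp add: steinhaus_seq_def U_def)
  have cis[measurable]: "(\<lambda>t. cis (2 * pi * t)) \<in> borel_measurable borel"
    by (intro borel_measurable_continuous_onI continuous_intros)
  have "AE z in distr U borel (\<lambda>t. cis (2 * pi * t)). norm z = 1"
    by (subst AE_distr_iff) auto
  then show abs: "AE \<omega> in M. norm (\<gamma> i \<omega>) = 1"
    unfolding d[symmetric] by (subst (asm) AE_distr_iff) auto
  have mean: "(\<integral>\<omega>. Re (z * \<gamma> i \<omega>) \<partial>M) = 0" for z
  proof -
    have "(\<integral>\<omega>. Re (z * \<gamma> i \<omega>) \<partial>M) = (\<integral>w. Re (z * w) \<partial>distr M borel (\<gamma> i))"
      by (subst integral_distr) auto
    also have "\<dots> = (\<integral>t. Re (z * cis (2 * pi * t)) \<partial>U)"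
      unfolding d by (subst integral_distr) auto
    also have "\<dots> = (\<integral>t. indicator {0..1} t *\<^sub>R Re (z * cis (2 * pi * t)) \<partial>lborel)"
      unfolding U by (subst integral_density) auto
    also have "\<dots> = (Re z * sin (2 * pi * 1) + Im z * cos (2 * pi * 1)) / (2 * pi)
        - (Re z * sin (2 * pi * 0) + Im z * cos (2 * pi * 0)) / (2 * pi)"
    proof (rule integral_FTC_Icc)
      fix t :: real
      show "((\<lambda>t. (Re z * sin (2 * pi * t) + Im z * cos (2 * pi * t)) / (2 * pi))
          has_vector_derivative Re (z * cis (2 * pi * t))) (at t within {0..1})"
        unfolding has_real_derivative_iff_has_vector_derivative[symmetric]
        by (auto intro!: derivative_eq_intros simp: field_simps)
    qed (auto intro!: continuous_intros)
    finally show ?thesis by simp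
  qed
  show "complex_subgaussian_with M (\<gamma> i) 1"
    unfolding complex_subgaussian_with_def
  proof (intro conjI allI)
    fix z :: complex
    \<comment> \<open>For fixed z the variable Re (z \<gamma>) is centred and bounded by |z|, so
      Hoeffding's lemma, evaluated at parameter 1, is already the complex bound.\<close>
    have "real_subgaussian_with M (\<lambda>\<omega>. Re (z * \<gamma> i \<omega>)) (norm z)"
    proof (rule real_subgaussian_bounded[OF prob_space_axioms _ _ mean])
      show "AE \<omega> in M. \<bar>Re (z * \<gamma> i \<omega>)\<bar> \<le> norm z"
        using abs by eventually_elim (metis abs_Re_le_cmod mult.right_neutral norm_mult)
    qed auto
    then have "(\<integral>\<^sup>+\<omega>. ennreal (exp (1 * Re (z * \<gamma> i \<omega>))) \<partial>M) \<le> ennreal (exp ((norm z)\<^sup>2 * 1\<^sup>2 / 2))"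
      unfolding real_subgaussian_with_def by blast
    then show "(\<integral>\<^sup>+\<omega>. ennreal (exp (Re (z * \<gamma> i \<omega>))) \<partial>M) \<le> ennreal (exp (1\<^sup>2 * (norm z)\<^sup>2 / 2))"
      by simp
  qed simp
qed

lemma distributed_normal_exp:
  assumes "distributed M lborel X (\<lambda>x. ennreal (normal_density 0 \<sigma> x))" "0 < \<sigma>"
  shows "(\<integral>\<^sup>+\<omega>. ennreal (exp (a * X \<omega>)) \<partial>M) = ennreal (exp (\<sigma>\<^sup>2 * a\<^sup>2 / 2))"
  using distributed_nn_integral[OF assms(1), of "\<lambda>x. ennreal (exp (a * x))"]
  by (simp add: nn_integral_normal_exp[OF assms(2)])

lemma distributed_normal_abs:
  assumes "distributed M lborel X (\<lambda>x. ennreal (normal_density 0 \<sigma> x))" "0 < \<sigma>"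
  shows "(\<integral>\<^sup>+\<omega>. ennreal \<bar>X \<omega>\<bar> \<partial>M) = ennreal (\<sigma> * sqrt (2 / pi))"
proof -
  have "(\<integral>\<^sup>+\<omega>. ennreal \<bar>X \<omega>\<bar> \<partial>M) = (\<integral>\<^sup>+x. ennreal (normal_density 0 \<sigma> x * \<bar>x\<bar>) \<partial>lborel)"
    using distributed_nn_integral[OF assms(1), of "\<lambda>x. ennreal \<bar>x\<bar>"] by (simp add: ennreal_mult')
  also have "\<dots> = ennreal (\<sigma> * sqrt (2 / pi))"
    using normal_moment_abs_odd[OF assms(2), of 0 0]
    by (subst nn_integral_eq_integral) (auto simp: has_bochner_integral_iff)
  finally show ?thesis .
qed

text \<open>1 / sqrt pi is the first absolute moment of a centred Gaussian of variance 1/2, the real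
  part in the complex case. This makes 1/2 a common lower bound for the mean modulus in all
  examples.\<close>

lemma half_le_sqrt_inverse_pi: "1 / 2 \<le> 1 / sqrt pi"
proof -
  have "sqrt pi \<le> sqrt 4" using pi_less_4 by (intro real_sqrt_le_mono) simp
  then show ?thesis by (intro divide_left_mono) auto
qed

lemma real_gaussian_seqD:
  assumes "real_gaussian_seq M \<gamma>"
  shows "real_subgaussian_with M (\<gamma> i) 1" "ennreal (1/2) \<le> (\<integral>\<^sup>+\<omega>. ennreal (norm (\<gamma> i \<omega>)) \<partial>M)"
proof -
  have d: "distributed M lborel (\<gamma> i) (\<lambda>x. ennreal (normal_density 0 1 x))"
    using assms by (simp add: real_gaussian_seq_def)
  show "real_subgaussian_with M (\<gamma> i) 1"
    using distributed_normal_exp[OF d] by (simp add: real_subgaussian_with_def)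
  have "1 / sqrt pi \<le> sqrt 2 / sqrt pi" by (intro divide_right_mono) auto
  then have "1 / 2 \<le> 1 * sqrt (2 / pi)"
    unfolding real_sqrt_divide mult_1 using half_le_sqrt_inverse_pi by (rule order.trans[rotated])
  then have "ennreal (1/2) \<le> ennreal (1 * sqrt (2 / pi))" by (rule ennreal_leI)
  also have "\<dots> = (\<integral>\<^sup>+\<omega>. ennreal \<bar>\<gamma> i \<omega>\<bar> \<partial>M)"
    by (rule distributed_normal_abs[OF d, symmetric]) simp
  finally show "ennreal (1/2) \<le> (\<integral>\<^sup>+\<omega>. ennreal (norm (\<gamma> i \<omega>)) \<partial>M)"
    by (simp only: real_norm_def)
qed

lemma complex_gaussian_seqD:
  assumes "complex_gaussian_seq M \<gamma>"
  shows "complex_subgaussian_with M (\<gamma> i) 1" "ennreal (1/2) \<le> (\<integral>\<^sup>+\<omega>. ennreal (norm (\<gamma> i \<omega>)) \<partial>M)"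
proof -
  have ind: "indep_seq M \<gamma>" using assms by (simp add: complex_gaussian_seq_def)
  then interpret prob_space M by (simp add: indep_seq_def)
  \<comment> \<open>The two parts form a family indexed by bool, so the product formula for
    independent families applies to Re (z \<gamma>) = Re z Re \<gamma> - Im z Im \<gamma>.\<close>
  define X where "X b \<omega> = (if b then Re (\<gamma> i \<omega>) else Im (\<gamma> i \<omega>))" for b \<omega>
  have dX: "distributed M lborel (X b) (\<lambda>x. ennreal (normal_density 0 (1 / sqrt 2) x))" for b
    using assms by (cases b) (auto simp: complex_gaussian_seq_def X_def[abs_def])
  have "indep_vars (case_bool borel borel) (case_bool (\<lambda>\<omega>. Re (\<gamma> i \<omega>)) (\<lambda>\<omega>. Im (\<gamma> i \<omega>))) UNIV"
    using assms by (simp add: complex_gaussian_seq_def indep_var_def)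
  then have indX: "indep_vars (\<lambda>_. borel) X UNIV"
    by (rule indep_vars_cong[THEN iffD1, rotated 3]) (auto simp: X_def[abs_def] split: bool.split)
  show "complex_subgaussian_with M (\<gamma> i) 1"
    unfolding complex_subgaussian_with_def
  proof (intro conjI allI)
    fix z :: complex
    define a where "a b = (if b then Re z else - Im z)" for b
    have "(\<integral>\<^sup>+\<omega>. ennreal (exp (Re (z * \<gamma> i \<omega>))) \<partial>M)
        = (\<integral>\<^sup>+\<omega>. (\<Prod>b\<in>UNIV. ennreal (exp (a b * X b \<omega>))) \<partial>M)"
      by (simp add: UNIV_bool a_def X_def mult_exp_exp flip: ennreal_mult)
    also have "\<dots> = (\<Prod>b\<in>UNIV. \<integral>\<^sup>+\<omega>. ennreal (exp (a b * X b \<omega>)) \<partial>M)"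
      by (rule indep_vars_nn_integral) (auto intro!: indep_vars_compose2[OF indX])
    also have "\<dots> = ennreal (exp ((norm z)\<^sup>2 / 4))"
      by (simp add: distributed_normal_exp[OF dX] UNIV_bool a_def power_divide cmod_power2
          mult_exp_exp add_divide_distrib flip: ennreal_mult)
    also have "\<dots> \<le> ennreal (exp (1\<^sup>2 * (norm z)\<^sup>2 / 2))" by (intro ennreal_leI) simp
    finally show "(\<integral>\<^sup>+\<omega>. ennreal (exp (Re (z * \<gamma> i \<omega>))) \<partial>M) \<le> ennreal (exp (1\<^sup>2 * (norm z)\<^sup>2 / 2))" .
  qed simp
  have "ennreal (1/2) \<le> ennreal (1 / sqrt 2 * sqrt (2 / pi))"
    using half_le_sqrt_inverse_pi by (intro ennreal_leI) (simp add: real_sqrt_divide)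
  also have "\<dots> = (\<integral>\<^sup>+\<omega>. ennreal \<bar>X True \<omega>\<bar> \<partial>M)"
    by (rule distributed_normal_abs[OF dX, symmetric]) simp
  also have "\<dots> \<le> (\<integral>\<^sup>+\<omega>. ennreal (norm (\<gamma> i \<omega>)) \<partial>M)"
    by (intro nn_integral_mono ennreal_leI) (simp add: X_def abs_Re_le_cmod)
  finally show "ennreal (1/2) \<le> (\<integral>\<^sup>+\<omega>. ennreal (norm (\<gamma> i \<omega>)) \<partial>M)" .
qed

lemma unimodular_mean:
  assumes "prob_space M" "AE \<omega> in M. norm (f \<omega>) = 1"
  shows "ennreal (1/2) \<le> (\<integral>\<^sup>+\<omega>. ennreal (norm (f \<omega>)) \<partial>M)"
proof -
  interpret prob_space M by fact
  have "(\<integral>\<^sup>+\<omega>. ennreal (norm (f \<omega>)) \<partial>M) = (\<integral>\<^sup>+\<omega>. 1 \<partial>M)"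
    using assms(2) by (intro nn_integral_cong_AE) (auto elim!: eventually_mono)
  then show ?thesis using ennreal_leI[of "1/2" 1] by (simp add: emeasure_space_1)
qed

section \<open>Lower bounds from sign patterns\<close>

text \<open>From t <= 1 + phi r t: every admissible \<epsilon> satisfies E Y <= \<epsilon> (1 + 1),
  whence the factor 1/2. The minorant \<open>Y\<close> allows a maximum to be replaced by an
  explicit sum of moduli.\<close>

lemma orlicz_norm_ge:
  assumes "prob_space M" and [measurable]: "Y \<in> borel_measurable M"
    and Y: "\<And>\<omega>. 0 \<le> Y \<omega>" "\<And>\<omega>. Y \<omega> \<le> \<bar>X \<omega>\<bar>" and r: "1 \<le> r"
    and m: "ennreal m \<le> (\<integral>\<^sup>+\<omega>. ennreal (Y \<omega>) \<partial>M)"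
  shows "ennreal (m / 2) \<le> orlicz_norm M r X"
  unfolding orlicz_norm_def
proof (rule INF_greatest, safe)
  interpret prob_space M by fact
  fix \<epsilon> :: real
  assume \<epsilon>: "0 < \<epsilon>" and le: "(\<integral>\<^sup>+\<omega>. ennreal (phi r (\<bar>X \<omega>\<bar> / \<epsilon>)) \<partial>M) \<le> 1"
  have pointwise: "Y \<omega> \<le> \<epsilon> * (1 + phi r (Y \<omega> / \<epsilon>))" for \<omega>
  proof -
    define t where "t = Y \<omega> / \<epsilon>"
    have t: "0 \<le> t" using Y \<epsilon> by (simp add: t_def)
    have "t \<le> 1 + t powr r"
    proof (cases "t \<le> 1")
      case False
      then have "t powr 1 \<le> t powr r" using r by (intro powr_mono) auto
      then show ?thesis using False by simp
    qed (simp add: add_increasing2)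
    also have "\<dots> \<le> 1 + phi r t" using exp_ge_add_one_self[of "t powr r"] by (simp add: phi_def)
    finally show ?thesis using \<epsilon> by (simp add: t_def field_simps)
  qed
  have [measurable]: "(\<lambda>\<omega>. phi r (Y \<omega> / \<epsilon>)) \<in> borel_measurable M" unfolding phi_def by measurable
  have phi0: "0 \<le> phi r t" for t by (simp add: phi_def)
  have "ennreal m \<le> (\<integral>\<^sup>+\<omega>. ennreal (Y \<omega>) \<partial>M)" by fact
  also have "\<dots> \<le> (\<integral>\<^sup>+\<omega>. ennreal \<epsilon> * (1 + ennreal (phi r (Y \<omega> / \<epsilon>))) \<partial>M)"
    using pointwise \<epsilon> phi0
    by (intro nn_integral_mono) (simp add: ennreal_leI flip: ennreal_1 ennreal_plus ennreal_mult)
  also have "\<dots> = ennreal \<epsilon> * (1 + (\<integral>\<^sup>+\<omega>. ennreal (phi r (Y \<omega> / \<epsilon>)) \<partial>M))"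
    by (simp add: nn_integral_cmult nn_integral_add emeasure_space_1)
  also have "\<dots> \<le> ennreal \<epsilon> * (1 + (\<integral>\<^sup>+\<omega>. ennreal (phi r (\<bar>X \<omega>\<bar> / \<epsilon>)) \<partial>M))"
  proof (intro mult_left_mono add_left_mono nn_integral_mono ennreal_leI)
    fix \<omega>
    have "Y \<omega> / \<epsilon> \<le> \<bar>X \<omega>\<bar> / \<epsilon>" using Y \<epsilon> by (intro divide_right_mono) auto
    then have "(Y \<omega> / \<epsilon>) powr r \<le> (\<bar>X \<omega>\<bar> / \<epsilon>) powr r" using Y \<epsilon> r by (intro powr_mono2) auto
    then show "phi r (Y \<omega> / \<epsilon>) \<le> phi r (\<bar>X \<omega>\<bar> / \<epsilon>)" by (simp add: phi_def)
  qed simp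
  also have "\<dots> \<le> ennreal \<epsilon> * (1 + 1)" by (intro mult_left_mono add_left_mono le) simp
  also have "\<dots> = ennreal (\<epsilon> * 2)" using \<epsilon> by (simp add: ennreal_mult one_add_one)
  finally have "m \<le> \<epsilon> * 2" using \<epsilon> by (simp add: ennreal_le_iff)
  then show "ennreal (m / 2) \<le> ennreal \<epsilon>" by (intro ennreal_leI) simp
qed

text \<open>
  The last sign is \<open>+1\<close>: this is possible up to a global sign, and leaves only \<open>2\<^bsup>k\<^esup>\<close> patterns
  for \<open>k + 1\<close> variables, so that \<open>N = 1\<close> needs no separate treatment.
\<close>

definition sign_choice :: "(nat \<Rightarrow> 'k::real_normed_field) \<Rightarrow> nat \<Rightarrow> bool" where
  "sign_choice x k \<longleftrightarrow> (\<exists>A\<subseteq>{..<k}. (\<Sum>i<Suc k. norm (x i)) / 2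
     \<le> norm (\<Sum>i<Suc k. x i * (if i \<in> A then -1 else 1)))"

lemma sign_pattern_real:
  fixes x :: "nat \<Rightarrow> real"
  obtains A where "A \<subseteq> {..<k}"
    "\<bar>\<Sum>i<Suc k. x i * (if i \<in> A then -1 else 1)\<bar> = (\<Sum>i<Suc k. \<bar>x i\<bar>)"
proof
  \<comment> \<open>The sign of \<open>x k\<close>. Using the signs of \<open>c * x i\<close> makes
    the last sign +1 and every signed term equal to c |x i|.\<close>
  define c :: real where "c = (if 0 \<le> x k then 1 else -1)"
  let ?A = "{i. i < k \<and> c * x i < 0}"
  show "?A \<subseteq> {..<k}" by auto
  have "x i * (if i \<in> ?A then -1 else 1) = c * \<bar>x i\<bar>" if "i < Suc k" for i
    using that by (cases "i = k") (auto simp: c_def)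
  then have "(\<Sum>i<Suc k. x i * (if i \<in> ?A then -1 else 1)) = c * (\<Sum>i<Suc k. \<bar>x i\<bar>)"
    unfolding sum_distrib_left by (intro sum.cong) auto
  then show "\<bar>\<Sum>i<Suc k. x i * (if i \<in> ?A then -1 else 1)\<bar> = (\<Sum>i<Suc k. \<bar>x i\<bar>)"
    by (simp only: abs_mult) (simp add: c_def sum_nonneg)
qed

lemma sign_choice_real: "sign_choice (x :: nat \<Rightarrow> real) k"
proof -
  obtain A where "A \<subseteq> {..<k}"
    "\<bar>\<Sum>i<Suc k. x i * (if i \<in> A then -1 else 1)\<bar> = (\<Sum>i<Suc k. \<bar>x i\<bar>)"
    by (rule sign_pattern_real)
  moreover have "(\<Sum>i<Suc k. \<bar>x i\<bar>) / 2 \<le> (\<Sum>i<Suc k. \<bar>x i\<bar>)"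
    using sum_nonneg[of "{..<Suc k}" "\<lambda>i. \<bar>x i\<bar>"] by simp
  ultimately show ?thesis unfolding sign_choice_def real_norm_def by metis
qed

text \<open>Signs cannot align complex numbers, but either the real or the imaginary parts carry at
  least half of the total modulus, and those can be aligned. This is the origin of the 1/2 in
  \<open>sign_choice\<close>.\<close>

lemma sign_choice_complex: "sign_choice (x :: nat \<Rightarrow> complex) k"
proof -
  have "(\<Sum>i<Suc k. norm (x i)) \<le> (\<Sum>i<Suc k. \<bar>Re (x i)\<bar> + \<bar>Im (x i)\<bar>)"
    by (intro sum_mono cmod_le)
  then have "(\<Sum>i<Suc k. norm (x i)) \<le> (\<Sum>i<Suc k. \<bar>Re (x i)\<bar>) + (\<Sum>i<Suc k. \<bar>Im (x i)\<bar>)"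
    by (simp only: sum.distrib)
  then consider "(\<Sum>i<Suc k. norm (x i)) / 2 \<le> (\<Sum>i<Suc k. \<bar>Re (x i)\<bar>)"
    | "(\<Sum>i<Suc k. norm (x i)) / 2 \<le> (\<Sum>i<Suc k. \<bar>Im (x i)\<bar>)" by argo
  then show ?thesis
  proof cases
    case 1
    obtain A where A: "A \<subseteq> {..<k}"
      "\<bar>\<Sum>i<Suc k. Re (x i) * (if i \<in> A then -1 else 1)\<bar> = (\<Sum>i<Suc k. \<bar>Re (x i)\<bar>)"
      by (rule sign_pattern_real)
    have "(\<Sum>i<Suc k. Re (x i) * (if i \<in> A then -1 else 1))
        = Re (\<Sum>i<Suc k. x i * (if i \<in> A then -1 else 1))"
      unfolding Re_sum by (intro sum.cong) auto
    then have "(\<Sum>i<Suc k. norm (x i)) / 2 \<le> norm (\<Sum>i<Suc k. x i * (if i \<in> A then -1 else 1))"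
      using 1 A(2) abs_Re_le_cmod order.trans by metis
    then show ?thesis unfolding sign_choice_def using A(1) by blast
  next
    case 2
    obtain A where A: "A \<subseteq> {..<k}"
      "\<bar>\<Sum>i<Suc k. Im (x i) * (if i \<in> A then -1 else 1)\<bar> = (\<Sum>i<Suc k. \<bar>Im (x i)\<bar>)"
      by (rule sign_pattern_real)
    have "(\<Sum>i<Suc k. Im (x i) * (if i \<in> A then -1 else 1))
        = Im (\<Sum>i<Suc k. x i * (if i \<in> A then -1 else 1))"
      unfolding Im_sum by (intro sum.cong) auto
    then have "(\<Sum>i<Suc k. norm (x i)) / 2 \<le> norm (\<Sum>i<Suc k. x i * (if i \<in> A then -1 else 1))"
      using 2 A(2) abs_Im_le_cmod order.trans by metis
    then show ?thesis unfolding sign_choice_def using A(1) by blast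
  qed
qed

text \<open>
  Test the estimate on a sign matrix whose \<open>N \<ge> 2\<^bsup>k\<^esup>\<close> columns contain all sign patterns: the
  maximum over the columns is then at least half of \<open>\<Sum>\<^sub>i \<bar>\<gamma>\<^sub>i\<bar>\<close>.
\<close>

lemma sum_estimate_lower:
  fixes \<gamma> :: "nat \<Rightarrow> 'w \<Rightarrow> 'k::{real_normed_field, second_countable_topology}"
  assumes "prob_space M" and [measurable]: "\<And>i. \<gamma> i \<in> borel_measurable M"
    and mean: "\<And>i. ennreal (1/2) \<le> (\<integral>\<^sup>+\<omega>. ennreal (norm (\<gamma> i \<omega>)) \<partial>M)"
    and r: "1 \<le> r" and N: "1 \<le> N"
    and S: "\<And>K x. 1 \<le> K \<Longrightarrow> (\<And>i. norm (x i) = 1) \<Longrightarrow> S K x = real K powr (1 - 1 / r)"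
    and sign: "\<And>k (x :: nat \<Rightarrow> 'k). sign_choice x k"
    and est: "sum_estimate M \<gamma> r S N c"
  shows "ennreal (1 / 16 * (1 + ln (real N)) powr (1/r)) \<le> c"
proof (cases "c = \<top>")
  case False
  then obtain c' where c': "c = ennreal c'" "0 \<le> c'" by (cases c) auto
  \<comment> \<open>The largest k with 2^k <= N, so all patterns for K = k + 1 rows fit into the
    columns, while K stays comparable to 1 + ln N.\<close>
  define k where "k = nat \<lfloor>log 2 (real N)\<rfloor>"
  define K where "K = Suc k"
  have "0 \<le> log 2 (real N)" using N by simp
  then have k: "real k \<le> log 2 (real N)" "log 2 (real N) < real k + 1"
    unfolding k_def by linarith+
  have "2 powr real k \<le> 2 powr (log 2 (real N))" using k by (intro powr_mono) auto
  then have "real (2 ^ k) \<le> real N" using N by (simp add: powr_realpow)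
  then have kN: "2 ^ k \<le> N" by (simp only: of_nat_le_iff)
  have "ln (real N) = log 2 (real N) * ln 2" by (simp add: log_def)
  also have "\<dots> \<le> (real k + 1) * 1"
    using k \<open>0 \<le> log 2 (real N)\<close> ln_2_less_1 by (intro mult_mono) auto
  finally have lnK: "1 + ln (real N) \<le> 2 * real K" by (simp add: K_def)
  obtain h where h: "bij_betw h {0..<2 ^ k :: nat} (Pow {..<k})"
    using ex_bij_betw_nat_finite[of "Pow {..<k}"] by (auto simp only: card_Pow finite_lessThan card_lessThan finite_Pow_iff)
  \<comment> \<open>For j beyond 2^k the set \<open>h j\<close> is unspecified, but the entries are
    still signs: such columns have the same norm and can only increase the maximum.\<close>
  define a :: "nat \<Rightarrow> nat \<Rightarrow> 'k" where "a i j = (if i \<in> h j then -1 else 1)" for i j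
  have max: "(MAX j\<in>{..<N}. S K (\<lambda>i. a i j)) = real K powr (1 - 1 / r)"
  proof -
    have "S K (\<lambda>i. a i j) = real K powr (1 - 1 / r)" for j
      by (intro S) (auto simp: K_def a_def)
    moreover have "{..<N} \<noteq> {}" using N by (auto simp: lessThan_empty_iff)
    ultimately show ?thesis by simp
  qed
  define Y where "Y \<omega> = (\<Sum>i<K. norm (\<gamma> i \<omega>)) / 2" for \<omega>
  have "ennreal (real K / 4) = (\<Sum>i<K. ennreal (1/2)) / 2"
    by (simp add: ennreal_of_nat_eq_real_of_nat divide_ennreal ennreal_mult'[symmetric]
        del: ennreal_half flip: ennreal_numeral)
  also have "\<dots> \<le> (\<Sum>i<K. \<integral>\<^sup>+\<omega>. ennreal (norm (\<gamma> i \<omega>)) \<partial>M) / 2"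
    by (intro divide_right_mono_ennreal sum_mono mean)
  also have "\<dots> = (\<integral>\<^sup>+\<omega>. (\<Sum>i<K. ennreal (norm (\<gamma> i \<omega>))) / 2 \<partial>M)"
    by (simp add: nn_integral_divide nn_integral_sum del: sum_ennreal)
  also have "\<dots> = (\<integral>\<^sup>+\<omega>. ennreal (Y \<omega>) \<partial>M)"
    by (simp add: Y_def divide_ennreal sum_nonneg flip: ennreal_numeral)
  finally have mean_Y: "ennreal (real K / 4) \<le> (\<integral>\<^sup>+\<omega>. ennreal (Y \<omega>) \<partial>M)" .
  have Y_le: "Y \<omega> \<le> \<bar>linf_norm N (\<lambda>j. \<Sum>i<K. \<gamma> i \<omega> * a i j)\<bar>" for \<omega>
  proof -
    obtain A where A: "A \<subseteq> {..<k}"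
      "(\<Sum>i<Suc k. norm (\<gamma> i \<omega>)) / 2 \<le> norm (\<Sum>i<Suc k. \<gamma> i \<omega> * (if i \<in> A then -1 else 1))"
      using sign[of "\<lambda>i. \<gamma> i \<omega>" k] unfolding sign_choice_def by blast
    have "A \<in> h ` {0..<2 ^ k}" using A(1) h by (simp add: bij_betw_def)
    then obtain j where j: "j < 2 ^ k" "h j = A" by auto
    have "Y \<omega> \<le> norm (\<Sum>i<K. \<gamma> i \<omega> * a i j)"
      using A(2) unfolding Y_def K_def a_def j(2) .
    also have "\<dots> \<le> linf_norm N (\<lambda>j. \<Sum>i<K. \<gamma> i \<omega> * a i j)"
      using j kN by (intro norm_le_linf_norm) linarith
    finally show ?thesis by linarith
  qed
  have "ennreal (real K / 4 / 2) \<le> orlicz_norm M r (\<lambda>\<omega>. linf_norm N (\<lambda>j. \<Sum>i<K. \<gamma> i \<omega> * a i j))"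
    using r Y_le mean_Y \<open>prob_space M\<close>
    by (intro orlicz_norm_ge[where Y = Y]) (auto simp: Y_def[abs_def] sum_nonneg)
  also have "\<dots> \<le> c * ennreal (MAX j\<in>{..<N}. S K (\<lambda>i. a i j))"
    by (rule est[unfolded sum_estimate_def, rule_format]) (simp add: K_def)
  also have "\<dots> = ennreal (c' * real K powr (1 - 1 / r))"
    by (simp only: max c' ennreal_mult[OF c'(2) powr_ge_zero])
  finally have "real K / 8 \<le> c' * real K powr (1 - 1 / r)"
    using c' by (simp add: ennreal_le_iff)
  moreover have "real K = real K powr (1 / r) * real K powr (1 - 1 / r)"
    by (simp add: K_def flip: powr_add)
  ultimately have "real K powr (1 / r) / 8 * real K powr (1 - 1 / r) \<le> c' * real K powr (1 - 1 / r)"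
    by simp
  then have "real K powr (1 / r) / 8 \<le> c'"
    by (rule mult_right_le_imp_le) (simp add: K_def)
  \<comment> \<open>The constant 1/16 collects four factors 1/2: the mean modulus, the sign choice,
    the comparison of Orlicz and L_1 norms, and 1 + ln N <= 2 K.\<close>
  moreover have "(1 + ln (real N)) powr (1/r) \<le> 2 * real K powr (1/r)"
  proof -
    have "(1 + ln (real N)) powr (1/r) \<le> (2 * real K) powr (1/r)"
      using lnK N r by (intro powr_mono2) auto
    also have "\<dots> = 2 powr (1/r) * real K powr (1/r)" by (simp add: powr_mult)
    also have "\<dots> \<le> 2 powr 1 * real K powr (1/r)"
      using r by (intro mult_right_mono powr_mono) auto
    finally show ?thesis by simp
  qed
  ultimately show ?thesis unfolding c'(1) by (intro ennreal_leI) simp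
qed simp

text \<open>The exponent is left as 1 - 1/2 so that both coefficient norms take the form K^(1 - 1/r)
  required by \<open>sum_estimate_lower\<close>.\<close>

lemma l2_norm_unimodular:
  assumes "\<And>i. norm (x i) = 1"
  shows "l2_norm K x = real K powr (1 - 1 / 2)"
  by (simp add: l2_norm_def L2_set_def assms powr_half_sqrt)

lemma weak_lp_norm_unimodular:
  assumes "\<And>i. norm (x i) = 1" "1 \<le> K" "0 < p"
  shows "weak_lp_norm p K x = real K powr (1 / p)"
proof -
  have one: "decreasing_rearrangement K x ! n = 1" if "n < K" for n
  proof -
    have "decreasing_rearrangement K x ! n \<in> set (decreasing_rearrangement K x)"
      using that by (intro nth_mem) (simp add: decreasing_rearrangement_def)
    then show ?thesis by (auto simp: decreasing_rearrangement_def assms(1))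
  qed
  show ?thesis
    unfolding weak_lp_norm_def
  proof (rule Max_eqI)
    show "real K powr (1 / p) \<in> (\<lambda>n. real (n + 1) powr (1 / p) * decreasing_rearrangement K x ! n) ` {..<K}"
      using assms by (intro image_eqI[of _ _ "K - 1"]) (auto simp: one)
  next
    fix y assume "y \<in> (\<lambda>n. real (n + 1) powr (1 / p) * decreasing_rearrangement K x ! n) ` {..<K}"
    then obtain n where "n < K" "y = real (n + 1) powr (1 / p)" by (auto simp: one)
    then show "y \<le> real K powr (1 / p)" using assms by (auto intro!: powr_mono2)
  qed simp
qed

section \<open>Two-sided bounds for the best constants\<close>

lemma best_constant_ge:
  fixes \<gamma> :: "nat \<Rightarrow> 'w \<Rightarrow> 'k::{real_normed_field, second_countable_topology}"
  assumes "indep_seq M \<gamma>" and mean: "\<And>i. ennreal (1/2) \<le> (\<integral>\<^sup>+\<omega>. ennreal (norm (\<gamma> i \<omega>)) \<partial>M)"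
    and r: "2 \<le> r" and N: "1 \<le> N" and sign: "\<And>k (x :: nat \<Rightarrow> 'k). sign_choice x k"
  shows "ennreal (1 / 16 * (1 + ln (real N)) powr (1/r)) \<le> best_constant M \<gamma> N r"
  unfolding best_constant_def
proof (rule Inf_greatest, safe)
  fix c assume est: "sum_estimate M \<gamma> r
    (if r = 2 then l2_norm else weak_lp_norm (conjugate_exponent r)) N c"
  have "(if r = 2 then l2_norm else weak_lp_norm (conjugate_exponent r)) K x = real K powr (1 - 1 / r)"
    if "1 \<le> K" "\<And>i. norm (x i) = 1" for K and x :: "nat \<Rightarrow> 'k"
  proof (cases "r = 2")
    case True
    then show ?thesis using that by (simp add: l2_norm_unimodular)
  next
    case False
    have "0 < conjugate_exponent r" "1 / conjugate_exponent r = 1 - 1 / r"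
      using r conjugate_exponent[of r] by (auto simp: conjugate_exponent_def)
    then show ?thesis using that False by (simp add: weak_lp_norm_unimodular)
  qed
  moreover have "prob_space M" using assms by (simp add: indep_seq_def)
  ultimately show "ennreal (1 / 16 * (1 + ln (real N)) powr (1/r)) \<le> c"
    using est indep_seq_measurable[OF assms(1)] mean r N sign by (intro sum_estimate_lower) auto
qed

lemma best_constant_2_le:
  assumes "indep_seq M \<gamma>" "\<And>i. complex_subgaussian_with M (\<gamma> i) 1" "1 \<le> N"
  shows "best_constant M \<gamma> N 2 \<le> ennreal (9 * (1 + ln (real N)) powr (1/2))"
  unfolding best_constant_def
  using subgaussian_l2_estimate[OF assms(1,2) _ assms(3)] by (intro Inf_lower) simp

lemma best_constant_weak_le:
  assumes "indep_seq M \<gamma>" "\<And>i. complex_subgaussian_with M (\<gamma> i) 1"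
    "\<And>i. AE \<omega> in M. norm (\<gamma> i \<omega>) = 1" "1 \<le> N" "2 < r"
  shows "best_constant M \<gamma> N r \<le> ennreal (weak_constant r 1 1 * (1 + ln (real N)) powr (1/r))"
  unfolding best_constant_def
proof (intro Inf_lower)
  have "AE \<omega> in M. norm (\<gamma> i \<omega>) \<le> 1" for i
    using assms(3)[of i] by eventually_elim simp
  then show "ennreal (weak_constant r 1 1 * (1 + ln (real N)) powr (1/r))
    \<in> {c. sum_estimate M \<gamma> r (if r = 2 then l2_norm else weak_lp_norm (conjugate_exponent r)) N c}"
    using subgaussian_weak_estimate[OF assms(1,2), of 1 r N] assms by simp
qed

text \<open>The chain runs from \<open>l\<close> through the real constant and the complex constant
  to \<open>u\<close>.\<close>

lemma best_constant_bounds_of_real: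
  assumes "l \<le> best_constant M \<gamma> N r"
    and "best_constant M (\<lambda>i \<omega>. complex_of_real (\<gamma> i \<omega>)) N r \<le> u"
  shows "best_constant M \<gamma> N r \<in> {l..u}
    \<and> best_constant M (\<lambda>i \<omega>. complex_of_real (\<gamma> i \<omega>)) N r \<in> {l..u}"
  unfolding atLeastAtMost_iff using assms best_constant_of_real_ge[of M \<gamma> N r] order.trans by blast

lemma best_constant_2_bounds_real:
  fixes \<gamma> :: "nat \<Rightarrow> 'w \<Rightarrow> real"
  assumes "real_gaussian_seq M \<gamma> \<or> rademacher_seq M \<gamma>" and N: "1 \<le> N"
  shows "best_constant M \<gamma> N 2
      \<in> {ennreal (1/16 * (1 + ln (real N)) powr (1/2)) .. ennreal (9 * (1 + ln (real N)) powr (1/2))} \<and>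
    best_constant M (\<lambda>i \<omega>. complex_of_real (\<gamma> i \<omega>)) N 2
      \<in> {ennreal (1/16 * (1 + ln (real N)) powr (1/2)) .. ennreal (9 * (1 + ln (real N)) powr (1/2))}"
proof (rule best_constant_bounds_of_real)
  have ind: "indep_seq M \<gamma>" using assms by (auto simp: real_gaussian_seq_def rademacher_seq_def)
  then have M: "prob_space M" by (simp add: indep_seq_def)
  have sub: "real_subgaussian_with M (\<gamma> i) 1" for i
    using assms real_gaussian_seqD rademacher_seqD by blast
  have mean: "ennreal (1/2) \<le> (\<integral>\<^sup>+\<omega>. ennreal (norm (\<gamma> i \<omega>)) \<partial>M)" for i
    using assms(1)
  proof
    assume "rademacher_seq M \<gamma>"
    then show ?thesis using rademacher_seqD(1) by (intro unimodular_mean[OF M]) simp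
  qed (rule real_gaussian_seqD)
  show "ennreal (1/16 * (1 + ln (real N)) powr (1/2)) \<le> best_constant M \<gamma> N 2"
    by (rule best_constant_ge[OF ind mean _ N sign_choice_real]) simp
  show "best_constant M (\<lambda>i \<omega>. complex_of_real (\<gamma> i \<omega>)) N 2 \<le> ennreal (9 * (1 + ln (real N)) powr (1/2))"
    by (intro best_constant_2_le indep_seq_of_real[OF ind] complex_subgaussian_with_of_real[OF sub] N)
qed

lemma best_constant_2_bounds_complex:
  assumes "complex_gaussian_seq M \<gamma> \<or> steinhaus_seq M \<gamma>" and N: "1 \<le> N"
  shows "best_constant M \<gamma> N 2
      \<in> {ennreal (1/16 * (1 + ln (real N)) powr (1/2)) .. ennreal (9 * (1 + ln (real N)) powr (1/2))}"
  unfolding atLeastAtMost_iff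
proof
  have ind: "indep_seq M \<gamma>" using assms by (auto simp: complex_gaussian_seq_def steinhaus_seq_def)
  then have M: "prob_space M" by (simp add: indep_seq_def)
  have sub: "complex_subgaussian_with M (\<gamma> i) 1" for i
    using assms complex_gaussian_seqD steinhaus_seqD by blast
  have mean: "ennreal (1/2) \<le> (\<integral>\<^sup>+\<omega>. ennreal (norm (\<gamma> i \<omega>)) \<partial>M)" for i
    using assms(1)
  proof
    assume "steinhaus_seq M \<gamma>"
    then show ?thesis using steinhaus_seqD(1) by (intro unimodular_mean[OF M])
  qed (rule complex_gaussian_seqD)
  show "ennreal (1/16 * (1 + ln (real N)) powr (1/2)) \<le> best_constant M \<gamma> N 2"
    by (rule best_constant_ge[OF ind mean _ N sign_choice_complex]) simp
  show "best_constant M \<gamma> N 2 \<le> ennreal (9 * (1 + ln (real N)) powr (1/2))"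
    by (rule best_constant_2_le[OF ind sub N])
qed

lemma best_constant_weak_bounds_real:
  fixes \<gamma> :: "nat \<Rightarrow> 'w \<Rightarrow> real"
  assumes "rademacher_seq M \<gamma>" and N: "1 \<le> N" and r: "2 < r"
  shows "best_constant M \<gamma> N r
      \<in> {ennreal (1/16 * (1 + ln (real N)) powr (1/r)) .. ennreal (weak_constant r 1 1 * (1 + ln (real N)) powr (1/r))} \<and>
    best_constant M (\<lambda>i \<omega>. complex_of_real (\<gamma> i \<omega>)) N r
      \<in> {ennreal (1/16 * (1 + ln (real N)) powr (1/r)) .. ennreal (weak_constant r 1 1 * (1 + ln (real N)) powr (1/r))}"
proof (rule best_constant_bounds_of_real)
  have ind: "indep_seq M \<gamma>" using assms by (simp add: rademacher_seq_def)
  then have M: "prob_space M" by (simp add: indep_seq_def)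
  note R = rademacher_seqD[OF assms(1)]
  show "ennreal (1/16 * (1 + ln (real N)) powr (1/r)) \<le> best_constant M \<gamma> N r"
    using R(1) r by (intro best_constant_ge ind N sign_choice_real unimodular_mean[OF M]) auto
  show "best_constant M (\<lambda>i \<omega>. complex_of_real (\<gamma> i \<omega>)) N r
      \<le> ennreal (weak_constant r 1 1 * (1 + ln (real N)) powr (1/r))"
    using R(1) by (intro best_constant_weak_le indep_seq_of_real[OF ind]
        complex_subgaussian_with_of_real[OF R(2)] N r) simp
qed

lemma best_constant_weak_bounds_complex:
  assumes "steinhaus_seq M \<gamma>" and N: "1 \<le> N" and r: "2 < r"
  shows "best_constant M \<gamma> N r
      \<in> {ennreal (1/16 * (1 + ln (real N)) powr (1/r)) .. ennreal (weak_constant r 1 1 * (1 + ln (real N)) powr (1/r))}"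
  unfolding atLeastAtMost_iff
proof
  have ind: "indep_seq M \<gamma>" using assms by (simp add: steinhaus_seq_def)
  then have M: "prob_space M" by (simp add: indep_seq_def)
  note R = steinhaus_seqD[OF assms(1)]
  show "ennreal (1/16 * (1 + ln (real N)) powr (1/r)) \<le> best_constant M \<gamma> N r"
    using R(1) r by (intro best_constant_ge ind N sign_choice_complex unimodular_mean[OF M]) auto
  show "best_constant M \<gamma> N r \<le> ennreal (weak_constant r 1 1 * (1 + ln (real N)) powr (1/r))"
    by (rule best_constant_weak_le[OF ind R(2,1) N r])
qed

theorem theorem5p2:
  shows
    "(\<exists>C :: real \<Rightarrow> real. \<forall>s. 0 < C s \<and>
        (\<forall>(M :: 'w measure) (\<gamma> :: nat \<Rightarrow> 'w \<Rightarrow> real). real_subgaussian_seq M \<gamma> s \<longrightarrow>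
          (\<forall>N\<ge>1. sum_estimate M \<gamma> 2 l2_norm N (ennreal (C s * (1 + ln (real N)) powr (1/2))) \<and>
             sum_estimate M (\<lambda>i \<omega>. complex_of_real (\<gamma> i \<omega>)) 2 l2_norm N
               (ennreal (C s * (1 + ln (real N)) powr (1/2))))) \<and>
        (\<forall>(M :: 'w measure) (\<gamma> :: nat \<Rightarrow> 'w \<Rightarrow> complex). complex_subgaussian_seq M \<gamma> s \<longrightarrow>
          (\<forall>N\<ge>1. sum_estimate M \<gamma> 2 l2_norm N (ennreal (C s * (1 + ln (real N)) powr (1/2))))))
     \<and>
     (\<forall>r>2. \<exists>C :: real \<Rightarrow> real \<Rightarrow> real. \<forall>s B. 0 < C s B \<and>
        (\<forall>(M :: 'w measure) (\<gamma> :: nat \<Rightarrow> 'w \<Rightarrow> real).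
          real_subgaussian_seq M \<gamma> s \<and> sup_Linf_norm M \<gamma> = ereal B \<longrightarrow>
          (\<forall>N\<ge>1. sum_estimate M \<gamma> r (weak_lp_norm (conjugate_exponent r)) N
               (ennreal (C s B * (1 + ln (real N)) powr (1/r))) \<and>
             sum_estimate M (\<lambda>i \<omega>. complex_of_real (\<gamma> i \<omega>)) r (weak_lp_norm (conjugate_exponent r)) N
               (ennreal (C s B * (1 + ln (real N)) powr (1/r))))) \<and>
        (\<forall>(M :: 'w measure) (\<gamma> :: nat \<Rightarrow> 'w \<Rightarrow> complex).
          complex_subgaussian_seq M \<gamma> s \<and> sup_Linf_norm M \<gamma> = ereal B \<longrightarrow>
          (\<forall>N\<ge>1. sum_estimate M \<gamma> r (weak_lp_norm (conjugate_exponent r)) N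
               (ennreal (C s B * (1 + ln (real N)) powr (1/r))))))
     \<and>
     (\<exists>c1>0. \<exists>c2>0. \<forall>N\<ge>1.
        (\<forall>(M :: 'w measure) (\<gamma> :: nat \<Rightarrow> 'w \<Rightarrow> real).
          real_gaussian_seq M \<gamma> \<or> rademacher_seq M \<gamma> \<longrightarrow>
            best_constant M \<gamma> N 2
              \<in> {ennreal (c1 * (1 + ln (real N)) powr (1/2)) .. ennreal (c2 * (1 + ln (real N)) powr (1/2))} \<and>
            best_constant M (\<lambda>i \<omega>. complex_of_real (\<gamma> i \<omega>)) N 2
              \<in> {ennreal (c1 * (1 + ln (real N)) powr (1/2)) .. ennreal (c2 * (1 + ln (real N)) powr (1/2))}) \<and>
        (\<forall>(M :: 'w measure) (\<gamma> :: nat \<Rightarrow> 'w \<Rightarrow> complex).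
          complex_gaussian_seq M \<gamma> \<or> steinhaus_seq M \<gamma> \<longrightarrow>
            best_constant M \<gamma> N 2
              \<in> {ennreal (c1 * (1 + ln (real N)) powr (1/2)) .. ennreal (c2 * (1 + ln (real N)) powr (1/2))}))
     \<and>
     (\<forall>r>2. \<exists>c1>0. \<exists>c2>0. \<forall>N\<ge>1.
        (\<forall>(M :: 'w measure) (\<gamma> :: nat \<Rightarrow> 'w \<Rightarrow> real). rademacher_seq M \<gamma> \<longrightarrow>
            best_constant M \<gamma> N r
              \<in> {ennreal (c1 * (1 + ln (real N)) powr (1/r)) .. ennreal (c2 * (1 + ln (real N)) powr (1/r))} \<and>
            best_constant M (\<lambda>i \<omega>. complex_of_real (\<gamma> i \<omega>)) N r
              \<in> {ennreal (c1 * (1 + ln (real N)) powr (1/r)) .. ennreal (c2 * (1 + ln (real N)) powr (1/r))}) \<and>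
        (\<forall>(M :: 'w measure) (\<gamma> :: nat \<Rightarrow> 'w \<Rightarrow> complex). steinhaus_seq M \<gamma> \<longrightarrow>
            best_constant M \<gamma> N r
              \<in> {ennreal (c1 * (1 + ln (real N)) powr (1/r)) .. ennreal (c2 * (1 + ln (real N)) powr (1/r))}))"
proof (intro conjI allI impI, goal_cases)
  case 1
  show ?case
    by (intro exI[of _ "\<lambda>s. 9 * (\<bar>s\<bar> + 1)"] allI conjI impI)
       (simp, (rule real_seq_l2_estimate complex_seq_l2_estimate; assumption)+)
next
  case (2 r)
  then show ?case
    by (intro exI[of _ "\<lambda>s B. weak_constant r (\<bar>s\<bar> + 1) \<bar>B\<bar>"] allI conjI impI; (elim conjE)?)
       (rule weak_constant_pos real_seq_weak_estimate complex_seq_weak_estimate; simp; fail)+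
next
  case 3
  show ?case
    \<comment> \<open>1/16 comes from \<open>best_constant_ge\<close>; 9 is
      \<open>9 * \<sigma>\<close> at \<sigma> = 1, a valid parameter for all four kinds of
      variables.\<close>
    by (rule exI[of _ "1/16"], intro conjI, simp, rule exI[of _ 9], intro conjI allI impI)
       (simp, (erule (1) best_constant_2_bounds_real[THEN conjunct1] best_constant_2_bounds_real[THEN conjunct2]
          best_constant_2_bounds_complex)+)
next
  case (4 r)
  then show ?case
    by (intro exI[of _ "1/16"] exI[of _ "weak_constant r 1 1"] allI conjI impI)
       (simp, simp add: weak_constant_pos, (rule best_constant_weak_bounds_real[THEN conjunct1]
          best_constant_weak_bounds_real[THEN conjunct2] best_constant_weak_bounds_complex; assumption)+)
qed

end
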